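(* Let $\mathcal H$ be a real Hilbert space, let $\phi:\mathcal H\to\mathbb R$ be a convex differentiable function whose gradient $\nabla\phi$ is Lipschitz continuous on the bounded subsets of $\mathcal H$, and let $A:\mathcal H\to\mathcal H$ be a maximal monotone operator which is $\lambda$-cocoercive for some $\lambda>0$. Let $\gamma>0$. Suppose that $S:=(\nabla\phi+A)^{-1}(0)=\{v\in\mathcal H:\nabla\phi(v)+Av=0\}\neq\emptyset$ and that $$\lambda\gamma^2>1 .$$ Then, for all initial data $u_0,v_0\in\mathcal H$, the Cauchy problem $$\ddot u(t)+\gamma\dot u(t)+\nabla\phi(u(t))+A(u(t))=0,\qquad u(0)=u_0,\ \dot u(0)=v_0,$$ has a unique solution $u\in C^2([0,+\infty);\mathcal H)$, and it satisfies: (i1) there exists $u_\infty\in S$ such that $u(t)\rightharpoonup u_\infty$ weakly in $\mathcal H$ as $t\to+\infty$; (i2) $\dot u\in L^2(0,+\infty;\mathcal H)$ and $\lim_{t\to+\infty}|\dot u(t)|=0$; (i3) $\ddot u+\nabla\phi(u)+Ap\in L^2(0,+\infty;\mathcal H)$ for every $p\in S$; (i4) for every $p\in S$, $\lim_{t\to+\infty}|u(t)-p|$ exists.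
   Context: $\langle\cdot,\cdot\rangle$ and $|\cdot|$ denote the scalar product and norm of $\mathcal H$. An operator $A:\mathcal H\to\mathcal H$ (single-valued, everywhere defined) is $\lambda$-cocoercive, $\lambda>0$, if $\langle Av-Aw,v-w\rangle\ge\lambda|Av-Aw|^2$ for all $v,w\in\mathcal H$. Dots denote derivatives with respect to time $t$. *)

theory Defs
  imports "HOL-Analysis.Analysis"
begin

text \<open>Real Hilbert spaces are types of sort \<open>{real_inner, complete_space}\<close>; no separability is assumed.\<close>

subsection \<open>Operators\<close>

text \<open>A (multivalued) operator is identified with its graph.\<close>

definition monotone_operator :: "('h::real_inner \<times> 'h) set \<Rightarrow> bool" where
  "monotone_operator G \<longleftrightarrow>
     (\<forall>(x, \<xi>)\<in>G. \<forall>(y, \<eta>)\<in>G. inner (\<xi> - \<eta>) (x - y) \<ge> 0)"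

definition maximal_monotone_operator :: "('h::real_inner \<times> 'h) set \<Rightarrow> bool" where
  "maximal_monotone_operator G \<longleftrightarrow>
     monotone_operator G \<and> (\<forall>G'. monotone_operator G' \<and> G \<subseteq> G' \<longrightarrow> G' = G)"

definition operator_graph :: "('h \<Rightarrow> 'h) \<Rightarrow> ('h \<times> 'h) set" where
  "operator_graph A = {(v, A v) |v. True}"

definition cocoercive :: "real \<Rightarrow> ('h::real_inner \<Rightarrow> 'h) \<Rightarrow> bool" where
  "cocoercive lam A \<longleftrightarrow>
     lam > 0 \<and> (\<forall>v w. inner (A v - A w) (v - w) \<ge> lam * (norm (A v - A w))\<^sup>2)"

definition zeros_of_sum :: "('h::real_inner \<Rightarrow> 'h) \<Rightarrow> ('h \<Rightarrow> 'h) \<Rightarrow> 'h set" where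
  "zeros_of_sum B A = {v. B v + A v = 0}"

subsection \<open>Trajectories on the closed half-line\<close>

text \<open>The derivative is taken within \<open>{0..}\<close>, so it is one-sided at \<open>0\<close>, and values of
  a trajectory at negative times are irrelevant.\<close>

definition time_deriv :: "(real \<Rightarrow> 'h::real_normed_vector) \<Rightarrow> real \<Rightarrow> 'h" where
  "time_deriv u t = vector_derivative u (at t within {0..})"

definition C2_half_line :: "(real \<Rightarrow> 'h::real_normed_vector) \<Rightarrow> bool" where
  "C2_half_line u \<longleftrightarrow>
     u differentiable_on {0..} \<and>
     time_deriv u differentiable_on {0..} \<and>
     continuous_on {0..} (time_deriv (time_deriv u))"

definition is_C2_solution ::
  "real \<Rightarrow> ('h::real_inner \<Rightarrow> 'h) \<Rightarrow> ('h \<Rightarrow> 'h) \<Rightarrow> 'h \<Rightarrow> 'h \<Rightarrow> (real \<Rightarrow> 'h) \<Rightarrow> bool" where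
  "is_C2_solution \<gamma> B A u0 v0 u \<longleftrightarrow>
     C2_half_line u \<and>
     (\<forall>t\<ge>0. time_deriv (time_deriv u) t + \<gamma> *\<^sub>R time_deriv u t + B (u t) + A (u t) = 0) \<and>
     u 0 = u0 \<and> time_deriv u 0 = v0"

definition weakly_tendsto :: "('b \<Rightarrow> 'h::real_inner) \<Rightarrow> 'h \<Rightarrow> 'b filter \<Rightarrow> bool" where
  "weakly_tendsto f l F \<longleftrightarrow> (\<forall>y. ((\<lambda>t. inner (f t) y) \<longlongrightarrow> inner l y) F)"

text \<open>Bochner (strong) measurability. For non-separable target spaces this is stronger than
  \<open>borel_measurable\<close>, and it is the measurability required in Bochner--Lebesgue spaces.\<close>

definition strongly_measurable :: "'b measure \<Rightarrow> ('b \<Rightarrow> 'h::real_normed_vector) \<Rightarrow> bool" where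
  "strongly_measurable M f \<longleftrightarrow>
     (\<exists>s. (\<forall>n::nat. simple_function M (s n)) \<and> (AE x in M. (\<lambda>n. s n x) \<longlonglongrightarrow> f x))"

definition in_L2_half_line :: "(real \<Rightarrow> 'h::real_normed_vector) \<Rightarrow> bool" where
  "in_L2_half_line f \<longleftrightarrow>
     strongly_measurable (lebesgue_on {0<..}) f \<and>
     integrable (lebesgue_on {0<..}) (\<lambda>t. (norm (f t))\<^sup>2)"

end

(* With G = <u - p, u'> + g/2 |u - p|^2 + (2/g) (|u'|^2/2 + phi(u) - phi(p) - <grad phi(p), u - p>)
   for p in S, where g is the damping, cocoercivity gives
   G' <= - |u'|^2 - (2/g) <Au - Ap, u'> - lam |Au - Ap|^2, a negative definite form in (u', Au - Ap)
   because lam g^2 > 1, while G dominates |u - p|^2 + |u'|^2. Hence trajectories are bounded and exist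
   globally, and u' and Au - Ap are square integrable. Lipschitz bounds on u' and u'' then give
   u' -> 0 and u'' -> 0, so that grad phi(u) + Au -> 0 strongly. Since the distances |u - p|
   converge, monotonicity (Minty) and Opial's argument give the weak limit. *)
theory Submission
  imports Defs
begin

subsection \<open>Lipschitz differential equations on the half-line\<close>

text \<open>Since \<open>A\<close> need not be a gradient, the mechanical energy |u'|^2/2 + phi(u)
  need not decrease: its rate contains <Au, u'>, which has no sign. Cocoercivity controls
  displacements, so it enters by pairing the equation with u - p, and this costs a term +|u'|^2 that
  the damping has to absorb. If the energy part is given a weight c, the rate is at most (1 - c g)
  |u'|^2 - c <Au - Ap, u'> - lam |Au - Ap|^2. This form is negative definite iff c g > 1 and c^2 < 4
  lam (c g - 1). The quotient c^2 / (4 (c g - 1)) is smallest at c = 2/g, where it equals 1/g^2, so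
  this single weight covers the whole range lam g^2 > 1. Convergence of G does not by itself give
  convergence of |u - p|, because G contains phi(u), whose limit is unknown. A second decreasing
  functional free of phi, apart from a multiple of G whose limit exists, isolates the
  distance.\<close>

lemma norm_weighted_integral_le:
  fixes g :: "real \<Rightarrow> 'a::banach"
  assumes "k > 0" "t \<ge> 0" "M \<ge> 0" and cont: "continuous_on {0..t} g"
    and bound: "\<And>s. s \<in> {0..t} \<Longrightarrow> norm (g s) \<le> M * exp (k * s)"
  shows "norm (exp (- k * t) *\<^sub>R integral {0..t} g) \<le> M / k"
proof -
  have I: "((\<lambda>s. M * exp (k * s)) has_integral (M * exp (k * t) / k - M * exp (k * 0) / k)) {0..t}"
    using assms
    by (intro fundamental_theorem_of_calculus)
       (auto intro!: derivative_eq_intros simp flip: has_real_derivative_iff_has_vector_derivative)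
  have "norm (integral {0..t} g) \<le> integral {0..t} (\<lambda>s. M * exp (k * s))"
    by (intro integral_norm_bound_integral bound integrable_continuous_real cont)
       (auto intro!: continuous_intros)
  also have "\<dots> \<le> M * exp (k * t) / k"
    using integral_unique[OF I] assms by simp
  finally have "exp (- k * t) * norm (integral {0..t} g) \<le> exp (- k * t) * (M * exp (k * t) / k)"
    by (intro mult_left_mono) auto
  also have "\<dots> = M / k"
    by (simp add: exp_minus)
  finally show ?thesis
    by simp
qed

lemma integral_has_vector_derivative_half_line:
  fixes g :: "real \<Rightarrow> 'a::banach"
  assumes "continuous_on {a..} g" "t \<ge> a"
  shows "((\<lambda>t. integral {a..t} g) has_vector_derivative g t) (at t within {a..})"
proof -
  have "((\<lambda>t. integral {a..t} g) has_vector_derivative g t) (at t within {a..t + 1})"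
    using assms by (intro integral_has_vector_derivative continuous_on_subset[OF assms(1)]) auto
  moreover have "at t within {a..t + 1} = at t within {a..}"
    by (rule at_within_nhd[of t "{..<t + 1}"]) auto
  ultimately show ?thesis
    by simp
qed

text \<open>Banach's fixed point theorem for \<open>y t = exp (- k t) (x t - x0)\<close>: the exponential weight
  makes the Picard operator a contraction on the whole half-line at once.\<close>

lemma lipschitz_ode_half_line_banach:
  fixes F :: "'a::banach \<Rightarrow> 'a"
  assumes lip: "L-lipschitz_on UNIV F"
  obtains x where "x 0 = x0" "\<And>t. t \<ge> 0 \<Longrightarrow> (x has_vector_derivative F (x t)) (at t within {0..})"
proof -
  \<comment> \<open>The contraction factor will be \<open>L / k\<close>, which is below 1/2; the
    summand 1 keeps \<open>k\<close> positive when \<open>L\<close> is 0.\<close>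
  define k where "k = 2 * L + 1"
  have L: "L \<ge> 0"
    using lip by (rule lipschitz_on_nonneg)
  hence k: "k > 0" "L / k < 1" "L / k \<ge> 0"
    by (auto simp: k_def)
  have contF [continuous_intros]: "continuous_on S (\<lambda>s. F (h s))"
    if "continuous_on S h" for S and h :: "real \<Rightarrow> 'a"
    using continuous_on_compose2[OF lipschitz_on_continuous_on[OF lip] that] by simp
  have F_dist: "norm (F a - F b) \<le> L * norm (a - b)" for a b
    using lipschitz_onD[OF lip, of a b] by (simp add: dist_norm)
  define g where "g y s = F (x0 + exp (k * s) *\<^sub>R apply_bcontfun y s)" for y s
  have contg [continuous_intros]: "continuous_on S (g y)" for S y
    unfolding g_def by (intro continuous_intros continuous_on_apply_bcontfun)
  define P where "P y t = integral {0..t} (g y)" for y t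
  have P_deriv: "(P y has_vector_derivative g y t) (at t within {0..})" if "t \<ge> 0" for y t
    unfolding P_def using that by (intro integral_has_vector_derivative_half_line contg)
  \<comment> \<open>Bounded continuous functions live on all of the real line, so the Picard image
    is extended to negative times by its value at 0.\<close>
  define N where "N y t = exp (- k * max 0 t) *\<^sub>R P y (max 0 t)" for y t
  have N_bcontfun: "N y \<in> bcontfun" for y
  proof (rule bcontfun_normI)
    have "continuous_on {0..} (P y)"
      by (auto simp: continuous_on_eq_continuous_within
               intro: has_vector_derivative_continuous P_deriv)
    hence "continuous_on UNIV (\<lambda>t. P y (max 0 t))"
      by (rule continuous_on_compose2) (auto intro!: continuous_intros)
    thus "continuous_on UNIV (N y)"
      unfolding N_def by (intro continuous_intros)
    fix t :: real
    have "norm (g y s) \<le> (norm (F x0) + L * norm y) * exp (k * s)" if "s \<ge> 0" for s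
    proof -
      have "norm (g y s) \<le> norm (F x0) + norm (g y s - F x0)"
        by (rule norm_triangle_sub)
      also have "norm (g y s - F x0) \<le> L * (exp (k * s) * norm (apply_bcontfun y s))"
        using F_dist[of "x0 + exp (k * s) *\<^sub>R apply_bcontfun y s" x0] by (simp add: g_def)
      also have "\<dots> \<le> L * (exp (k * s) * norm y)"
        using L by (intro mult_left_mono norm_bounded) auto
      also have "norm (F x0) \<le> norm (F x0) * exp (k * s)"
        using that k by (intro mult_le_cancel_left1[THEN iffD2]) auto
      finally show ?thesis
        by (simp add: algebra_simps)
    qed
    thus "norm (N y t) \<le> (norm (F x0) + L * norm y) / k"
      unfolding N_def P_def using k L
      by (intro norm_weighted_integral_le contg) auto
  qed
  define T where "T y = Bcontfun (N y)" for y
  have T: "apply_bcontfun (T y) = N y" for y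
    using N_bcontfun by (simp add: T_def Bcontfun_inverse)
  have "dist (T y) (T z) \<le> L / k * dist y z" for y z
  proof (rule dist_bound)
    fix t :: real
    define \<tau> where "\<tau> = max 0 t"
    have "N y t - N z t = exp (- k * \<tau>) *\<^sub>R integral {0..\<tau>} (\<lambda>s. g y s - g z s)"
      unfolding N_def P_def \<tau>_def[symmetric]
      by (subst integral_diff)
         (auto intro!: integrable_continuous_real contg simp: scaleR_diff_right)
    also have "norm \<dots> \<le> L * dist y z / k"
    proof (rule norm_weighted_integral_le)
      fix s
      have "norm (g y s - g z s) \<le>
            L * norm ((x0 + exp (k * s) *\<^sub>R apply_bcontfun y s) - (x0 + exp (k * s) *\<^sub>R apply_bcontfun z s))"
        unfolding g_def by (rule F_dist)
      also have "\<dots> = L * (exp (k * s) * dist (apply_bcontfun y s) (apply_bcontfun z s))"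
        by (simp add: dist_norm flip: scaleR_diff_right)
      also have "\<dots> \<le> L * (exp (k * s) * dist y z)"
        using L by (intro mult_left_mono dist_bounded) auto
      finally show "norm (g y s - g z s) \<le> L * dist y z * exp (k * s)"
        by (simp add: mult_ac)
    qed (use k L in \<open>auto intro!: continuous_intros simp: \<tau>_def\<close>)
    finally show "dist (apply_bcontfun (T y) t) (apply_bcontfun (T z) t) \<le> L / k * dist y z"
      by (simp add: T dist_norm)
  qed
  then obtain y where y: "T y = y"
    using banach_fix_type[of "L / k" T] k by blast
  \<comment> \<open>Written as an integral, the solution is differentiable at once. The form with
    \<open>exp (k * t)\<close>, in which the fixed point enters \<open>F\<close>, agrees with it for
    nonnegative times.\<close>
  define x where "x t = x0 + P y t" for t
  have x_eq: "x t = x0 + exp (k * t) *\<^sub>R apply_bcontfun y t" if "t \<ge> 0" for t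
  proof -
    have "apply_bcontfun y t = exp (- k * t) *\<^sub>R P y t"
      using T[of y] y that by (simp add: N_def)
    thus ?thesis
      by (simp add: x_def flip: exp_add)
  qed
  show ?thesis
  proof
    show "x 0 = x0"
      by (simp add: x_def P_def)
    show "(x has_vector_derivative F (x t)) (at t within {0..})" if "t \<ge> 0" for t
    proof -
      have "F (x t) = g y t"
        using x_eq[OF that] by (simp add: g_def)
      thus ?thesis
        unfolding x_def[abs_def] using has_vector_derivative_add[OF has_vector_derivative_const P_deriv[OF that, of y]] by simp
    qed
  qed
qed

text \<open>The vector-valued integral of the library requires the class \<^class>\<open>banach\<close>, and the
  sort \<open>{real_normed_vector, complete_space}\<close> is not a subsort of it. A copy of the type is
  used to transport the existence theorem.\<close>

typedef 'a banach_copy = "UNIV :: 'a set"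
  morphisms of_copy to_copy by simp

setup_lifting type_definition_banach_copy

instantiation banach_copy :: (real_normed_vector) real_normed_vector
begin

lift_definition zero_banach_copy :: "'a banach_copy" is 0 .
lift_definition plus_banach_copy :: "'a banach_copy \<Rightarrow> 'a banach_copy \<Rightarrow> 'a banach_copy" is "(+)" .
lift_definition minus_banach_copy :: "'a banach_copy \<Rightarrow> 'a banach_copy \<Rightarrow> 'a banach_copy" is "(-)" .
lift_definition uminus_banach_copy :: "'a banach_copy \<Rightarrow> 'a banach_copy" is uminus .
lift_definition scaleR_banach_copy :: "real \<Rightarrow> 'a banach_copy \<Rightarrow> 'a banach_copy" is scaleR .
lift_definition norm_banach_copy :: "'a banach_copy \<Rightarrow> real" is norm .
lift_definition dist_banach_copy :: "'a banach_copy \<Rightarrow> 'a banach_copy \<Rightarrow> real" is dist .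
lift_definition sgn_banach_copy :: "'a banach_copy \<Rightarrow> 'a banach_copy" is sgn .
definition uniformity_banach_copy :: "('a banach_copy \<times> 'a banach_copy) filter" where
  "uniformity_banach_copy = (INF e\<in>{0 <..}. principal {(x, y). dist x y < e})"
definition open_banach_copy :: "'a banach_copy set \<Rightarrow> bool" where
  "open_banach_copy S = (\<forall>x\<in>S. \<forall>\<^sub>F (x', y) in uniformity. x' = x \<longrightarrow> y \<in> S)"

instance
proof
  show "x + y + z = x + (y + z)" "x + y = y + x" "0 + x = x" "- x + x = 0" "x - y = x + - y"
    "a *\<^sub>R (x + y) = a *\<^sub>R x + a *\<^sub>R y" "(a + b) *\<^sub>R x = a *\<^sub>R x + b *\<^sub>R x"
    "a *\<^sub>R b *\<^sub>R x = (a * b) *\<^sub>R x" "1 *\<^sub>R x = x"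
    for x y z :: "'a banach_copy" and a b :: real
    by (transfer; simp add: algebra_simps)+
  show "dist x y = norm (x - y)" "sgn x = inverse (norm x) *\<^sub>R x" "norm x = 0 \<longleftrightarrow> x = 0"
    "norm (a *\<^sub>R x) = \<bar>a\<bar> * norm x" for x y :: "'a banach_copy" and a :: real
    by (transfer; simp add: dist_norm sgn_div_norm divide_inverse_commute)+
  show "norm (x + y) \<le> norm x + norm y" for x y :: "'a banach_copy"
    by transfer (rule norm_triangle_ineq)
qed (rule uniformity_banach_copy_def open_banach_copy_def)+

end

instance banach_copy :: ("{real_normed_vector, complete_space}") banach
proof
  fix X :: "nat \<Rightarrow> 'a banach_copy"
  assume "Cauchy X"
  hence "Cauchy (\<lambda>n. of_copy (X n))"
    by (simp add: Cauchy_def dist_banach_copy.rep_eq)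
  then obtain l where "(\<lambda>n. of_copy (X n)) \<longlonglongrightarrow> l"
    using Cauchy_convergent convergent_def by blast
  hence "X \<longlonglongrightarrow> to_copy l"
    by (simp add: lim_sequentially dist_banach_copy.rep_eq to_copy_inverse)
  thus "convergent X"
    by (rule convergentI)
qed

lemma bounded_linear_of_copy: "bounded_linear of_copy"
  by (rule bounded_linear_intro[where K = 1])
     (simp_all add: plus_banach_copy.rep_eq scaleR_banach_copy.rep_eq norm_banach_copy.rep_eq)

lemma lipschitz_ode_half_line:
  fixes F :: "'a::{real_normed_vector, complete_space} \<Rightarrow> 'a"
  assumes lip: "L-lipschitz_on UNIV F"
  obtains x where "x 0 = x0" "\<And>t. t \<ge> 0 \<Longrightarrow> (x has_vector_derivative F (x t)) (at t within {0..})"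
proof -
  have "L-lipschitz_on UNIV (\<lambda>x. to_copy (F (of_copy x)))"
    using lip by (simp add: lipschitz_on_def dist_banach_copy.rep_eq to_copy_inverse)
  then obtain x where x: "x 0 = to_copy x0"
    "\<And>t. t \<ge> 0 \<Longrightarrow> (x has_vector_derivative to_copy (F (of_copy (x t)))) (at t within {0..})"
    using lipschitz_ode_half_line_banach[where ?x0.0 = "to_copy x0"] by blast
  show ?thesis
  proof
    show "of_copy (x 0) = x0"
      by (simp add: x to_copy_inverse)
    show "((\<lambda>t. of_copy (x t)) has_vector_derivative F (of_copy (x t))) (at t within {0..})"
      if "t \<ge> 0" for t
      using bounded_linear.has_vector_derivative[OF bounded_linear_of_copy x(2)[OF that]]
      by (simp add: to_copy_inverse)
  qed
qed

lemma damped_lipschitz_equation: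
  fixes g :: "'h::{real_inner, complete_space} \<Rightarrow> 'h"
  assumes lip: "L-lipschitz_on UNIV g"
  obtains u v where "u 0 = u0" "v 0 = v0"
    "\<And>t. t \<ge> 0 \<Longrightarrow> (u has_vector_derivative v t) (at t within {0..})"
    "\<And>t. t \<ge> 0 \<Longrightarrow> (v has_vector_derivative - (\<gamma> *\<^sub>R v t) - g (u t)) (at t within {0..})"
proof -
  define F where "F z = (snd z, - (\<gamma> *\<^sub>R snd z) - g (fst z))" for z :: "'h \<times> 'h"
  have L: "L \<ge> 0"
    using lip by (rule lipschitz_on_nonneg)
  have "(1 + \<bar>\<gamma>\<bar> + L)-lipschitz_on UNIV F"
  proof (rule lipschitz_onI)
    fix z w :: "'h \<times> 'h"
    have "dist (F z) (F w) = norm (snd z - snd w, - (\<gamma> *\<^sub>R (snd z - snd w)) - (g (fst z) - g (fst w)))"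
      by (simp add: F_def dist_norm algebra_simps)
    also have "\<dots> \<le> norm (snd z - snd w) + norm (- (\<gamma> *\<^sub>R (snd z - snd w)) - (g (fst z) - g (fst w)))"
      by (rule norm_Pair_le)
    also have "\<dots> \<le> norm (snd z - snd w) + (\<bar>\<gamma>\<bar> * norm (snd z - snd w) + norm (g (fst z) - g (fst w)))"
      using norm_triangle_ineq4[of "- (\<gamma> *\<^sub>R (snd z - snd w))" "g (fst z) - g (fst w)"] by simp
    also have "norm (g (fst z) - g (fst w)) \<le> L * norm (fst z - fst w)"
      using lipschitz_onD[OF lip, of "fst z" "fst w"] by (simp add: dist_norm)
    also have "norm (snd z - snd w) + (\<bar>\<gamma>\<bar> * norm (snd z - snd w) + L * norm (fst z - fst w)) \<le>
               norm (z - w) + (\<bar>\<gamma>\<bar> * norm (z - w) + L * norm (z - w))"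
      using norm_fst_le[of "fst z - fst w" "snd z - snd w"] norm_snd_le[of "snd z - snd w" "fst z - fst w"] L
      by (intro add_mono mult_left_mono) (auto simp: minus_prod_def)
    finally show "dist (F z) (F w) \<le> (1 + \<bar>\<gamma>\<bar> + L) * dist z w"
      by (simp add: algebra_simps dist_norm)
  qed (use L in simp)
  then obtain x where x: "x 0 = (u0, v0)"
    "\<And>t. t \<ge> 0 \<Longrightarrow> (x has_vector_derivative F (x t)) (at t within {0..})"
    using lipschitz_ode_half_line[where ?x0.0 = "(u0, v0)"] by blast
  show ?thesis
  proof
    fix t :: real assume "t \<ge> 0"
    note bounded_linear.has_vector_derivative[OF bounded_linear_fst x(2)[OF this]]
      bounded_linear.has_vector_derivative[OF bounded_linear_snd x(2)[OF this]]
    thus "((\<lambda>t. fst (x t)) has_vector_derivative snd (x t)) (at t within {0..})"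
      "((\<lambda>t. snd (x t)) has_vector_derivative - (\<gamma> *\<^sub>R snd (x t)) - g (fst (x t))) (at t within {0..})"
      by (simp_all add: F_def)
  qed (simp_all add: x)
qed

subsection \<open>Barbalat-type lemmas and square integrability\<close>

lemma antimono_bounded_below_tendsto:
  fixes f :: "real \<Rightarrow> real"
  assumes anti: "\<And>s t. a \<le> s \<Longrightarrow> s \<le> t \<Longrightarrow> f t \<le> f s" and bd: "\<And>t. a \<le> t \<Longrightarrow> m \<le> f t"
  obtains l where "(f \<longlongrightarrow> l) at_top"
proof -
  have bdd: "bdd_below (f ` {a..})"
    using bd by (auto intro!: bdd_belowI2)
  have "(f \<longlongrightarrow> Inf (f ` {a..})) at_top"
  proof (rule decreasing_tendsto)
    show "\<forall>\<^sub>F t in at_top. Inf (f ` {a..}) \<le> f t"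
      using eventually_ge_at_top[of a] by eventually_elim (auto intro!: cINF_lower bdd)
    fix y assume "Inf (f ` {a..}) < y"
    then obtain s where "s \<ge> a" "f s < y"
      using cINF_less_iff[OF _ bdd] by auto
    show "\<forall>\<^sub>F t in at_top. f t < y"
      using eventually_ge_at_top[of s]
      by eventually_elim (use anti \<open>s \<ge> a\<close> \<open>f s < y\<close> in force)
  qed
  thus ?thesis
    by (rule that)
qed

text \<open>Derivatives along trajectories are one-sided at time 0. Continuity is therefore taken
  from the derivatives within \<open>X\<close>, while the sign is evaluated at interior points of
  the interval, where the derivative is two-sided.\<close>

lemma has_real_derivative_within_nonpos_antimono:
  fixes f :: "real \<Rightarrow> real"
  assumes "s \<le> t" and sub: "{s..t} \<subseteq> X"
    and deriv: "\<And>x. x \<in> {s..t} \<Longrightarrow> (f has_real_derivative f' x) (at x within X)"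
    and nonpos: "\<And>x. x \<in> {s..t} \<Longrightarrow> f' x \<le> 0"
  shows "f t \<le> f s"
proof (rule DERIV_nonpos_imp_decreasing_open[OF \<open>s \<le> t\<close>])
  have d: "(f has_real_derivative f' x) (at x within {s..t})" if "x \<in> {s..t}" for x
    using deriv[OF that] sub by (rule DERIV_subset)
  thus "continuous_on {s..t} f"
    by (rule DERIV_continuous_on)
  show "\<exists>y. (f has_real_derivative y) (at x) \<and> y \<le> 0" if "s < x" "x < t" for x
    using d[of x] nonpos[of x] that by (auto simp: at_within_Icc_at)
qed

lemma norm_diff_le_vector_derivative_bound:
  fixes f :: "real \<Rightarrow> 'a::real_normed_vector"
  assumes "convex X" and deriv: "\<And>x. x \<in> X \<Longrightarrow> (f has_vector_derivative f' x) (at x within X)"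
    and bound: "\<And>x. x \<in> X \<Longrightarrow> norm (f' x) \<le> B" and "x \<in> X" "y \<in> X"
  shows "norm (f x - f y) \<le> B * \<bar>x - y\<bar>"
proof -
  have "norm (f x - f y) \<le> B * norm (x - y)"
  proof (rule differentiable_bound[OF \<open>convex X\<close> deriv[unfolded has_vector_derivative_def]])
    show "onorm (\<lambda>h. h *\<^sub>R f' z) \<le> B" if "z \<in> X" for z
      using mult_left_mono[OF bound[OF that] abs_ge_zero] by (intro onorm_le) (simp add: mult.commute)
  qed (use assms in auto)
  thus ?thesis
    by simp
qed

text \<open>Barbalat's argument without integrals: if \<open>g t\<close> were at least
  \<open>e\<close> at a late time, the Lipschitz bound would keep \<open>g\<close> above
  \<open>e / 2\<close> on a window of fixed length, and \<open>V\<close> would drop by a fixed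
  amount there, although \<open>V\<close> converges.\<close>

lemma dissipation_tendsto_zero:
  fixes V g :: "real \<Rightarrow> real"
  assumes deriv: "\<And>t. t \<ge> 0 \<Longrightarrow> (V has_real_derivative V' t) (at t within {0..})"
    and diss: "\<And>t. t \<ge> 0 \<Longrightarrow> g t \<le> - V' t"
    and V: "\<And>t. t \<ge> 0 \<Longrightarrow> V t \<ge> 0" and g: "\<And>t. t \<ge> 0 \<Longrightarrow> g t \<ge> 0"
    and lip: "\<And>s t. s \<ge> 0 \<Longrightarrow> t \<ge> 0 \<Longrightarrow> \<bar>g s - g t\<bar> \<le> K * \<bar>s - t\<bar>"
  shows "(g \<longlongrightarrow> 0) at_top"
proof -
  have "V' t \<le> 0" if "t \<ge> 0" for t
    using diss g that by fastforce
  hence "V t \<le> V s" if "0 \<le> s" "s \<le> t" for s t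
    using that by (intro has_real_derivative_within_nonpos_antimono[OF _ _ deriv]) auto
  then obtain l where l: "(V \<longlongrightarrow> l) at_top"
    using V antimono_bounded_below_tendsto[of 0 V 0] by blast
  show ?thesis
  proof (rule order_tendstoI)
    fix e :: real assume "e > 0"
    \<comment> \<open>On a window of this length \<open>g\<close> changes by at most
      \<open>e / 2\<close>. The absolute value and the summand 1 allow any real
      \<open>K\<close>.\<close>
    define \<eta> where "\<eta> = e / (2 * (\<bar>K\<bar> + 1))"
    have \<eta>: "\<eta> > 0" "\<bar>K\<bar> * \<eta> \<le> e / 2"
    proof -
      have "\<bar>K\<bar> + 1 > 0"
        by simp
      thus "\<eta> > 0" "\<bar>K\<bar> * \<eta> \<le> e / 2"
        using \<open>e > 0\<close> by (auto simp: \<eta>_def pos_divide_le_eq algebra_simps)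
    qed
    \<comment> \<open>Two values of \<open>V\<close> within \<open>e / 4 * \<eta>\<close> of the
      limit differ by less than \<open>e / 2 * \<eta>\<close>, the drop forced on one
      window.\<close>
    have "\<forall>\<^sub>F t in at_top. dist (V t) l < e / 4 * \<eta>"
      using \<open>e > 0\<close> \<eta> by (intro tendstoD[OF l]) auto
    then obtain T where T: "dist (V t) l < e / 4 * \<eta>" if "t \<ge> T" for t
      by (auto simp: eventually_at_top_linorder)
    show "\<forall>\<^sub>F t in at_top. g t < e"
      using eventually_ge_at_top[of "max 0 T"]
    proof eventually_elim
      case (elim t)
      show ?case
      proof (rule ccontr)
        assume "\<not> g t < e"
        hence ge: "g s \<ge> e / 2" if "s \<in> {t..t + \<eta>}" for s
        proof -
          have "K * \<bar>t - s\<bar> \<le> \<bar>K\<bar> * \<eta>"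
            using that by (intro mult_mono) auto
          also have "\<dots> \<le> e / 2"
            by (rule \<eta>)
          finally show ?thesis
            using lip[of t s] that elim \<open>\<not> g t < e\<close> by auto
        qed
        have "V (t + \<eta>) + e / 2 * (t + \<eta>) \<le> V t + e / 2 * t"
        proof (rule has_real_derivative_within_nonpos_antimono[where X = "{0..}"
              and f = "\<lambda>s. V s + e / 2 * s" and f' = "\<lambda>s. V' s + e / 2"])
          fix s assume s: "s \<in> {t..t + \<eta>}"
          show "((\<lambda>s. V s + e / 2 * s) has_real_derivative V' s + e / 2) (at s within {0..})"
            using s elim by (auto intro!: derivative_eq_intros deriv)
          show "V' s + e / 2 \<le> 0"
            using diss[of s] ge[OF s] s elim by auto
        qed (use elim \<eta> in auto)
        hence "e / 2 * \<eta> \<le> V t - V (t + \<eta>)"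
          by (simp add: field_simps)
        thus False
          using T[of t] T[of "t + \<eta>"] elim \<eta> unfolding dist_real_def by argo
      qed
    qed
  next
    fix e :: real assume "e < 0"
    show "\<forall>\<^sub>F t in at_top. g t > e"
      using eventually_ge_at_top[of 0] by eventually_elim (use g \<open>e < 0\<close> in force)
  qed
qed

text \<open>The mean of \<open>w\<close> over a window of length \<open>\<eta>\<close> is the
  increment of \<open>v\<close> divided by \<open>\<eta>\<close>, hence eventually small, and
  \<open>w t\<close> differs from that mean by at most \<open>K * \<eta>\<close>.\<close>

lemma lipschitz_derivative_tendsto_zero:
  fixes v w :: "real \<Rightarrow> 'a::real_normed_vector"
  assumes v: "(v \<longlongrightarrow> 0) at_top"
    and deriv: "\<And>t. t \<ge> 0 \<Longrightarrow> (v has_vector_derivative w t) (at t within {0..})"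
    and lip: "K-lipschitz_on {0..} w"
  shows "(w \<longlongrightarrow> 0) at_top"
proof (rule tendstoI)
  fix e :: real assume "e > 0"
  have K: "K \<ge> 0"
    using lip by (rule lipschitz_on_nonneg)
  define \<eta> where "\<eta> = e / (2 * (K + 1))"
  have \<eta>: "\<eta> > 0" "K * \<eta> < e / 2"
    using \<open>e > 0\<close> K by (auto simp: \<eta>_def field_simps)
  have "\<forall>\<^sub>F t in at_top. dist (v t) 0 < e / 4 * \<eta>"
    using \<open>e > 0\<close> \<eta> by (intro tendstoD[OF v]) auto
  then obtain T where T: "norm (v t) < e / 4 * \<eta>" if "t \<ge> T" for t
    by (auto simp: eventually_at_top_linorder)
  show "\<forall>\<^sub>F t in at_top. dist (w t) 0 < e"
    using eventually_ge_at_top[of "max 0 T"]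
  proof eventually_elim
    case (elim t)
    define f where "f s = v s - s *\<^sub>R w t" for s
    have "norm (f (t + \<eta>) - f t) \<le> K * \<eta> * \<bar>(t + \<eta>) - t\<bar>"
    proof (rule norm_diff_le_vector_derivative_bound[where X = "{t..t + \<eta>}"])
      fix s assume s: "s \<in> {t..t + \<eta>}"
      show "(f has_vector_derivative w s - w t) (at s within {t..t + \<eta>})"
        unfolding f_def using s elim
        by (auto intro!: derivative_eq_intros has_vector_derivative_within_subset[OF deriv])
      have "norm (w s - w t) \<le> K * \<bar>s - t\<bar>"
        using lipschitz_onD[OF lip, of s t] s elim by (simp add: dist_norm)
      also have "\<dots> \<le> K * \<eta>"
        using s K by (intro mult_left_mono) auto
      finally show "norm (w s - w t) \<le> K * \<eta>" .
    qed (use \<eta> in auto)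
    moreover have "f (t + \<eta>) - f t = v (t + \<eta>) - v t - \<eta> *\<^sub>R w t"
      by (simp add: f_def algebra_simps)
    ultimately have "norm (v (t + \<eta>) - v t - \<eta> *\<^sub>R w t) \<le> (K * \<eta>) * \<eta>"
      using \<eta> by simp
    moreover have "norm (\<eta> *\<^sub>R w t) \<le> norm (v (t + \<eta>)) + norm (v t) + norm (v (t + \<eta>) - v t - \<eta> *\<^sub>R w t)"
      proof -
      have "norm (\<eta> *\<^sub>R w t) = norm ((v (t + \<eta>) - v t) - (v (t + \<eta>) - v t - \<eta> *\<^sub>R w t))"
        by simp
      also have "\<dots> \<le> norm (v (t + \<eta>) - v t) + norm (v (t + \<eta>) - v t - \<eta> *\<^sub>R w t)"
        by (rule norm_triangle_ineq4)
      finally show ?thesis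
        using norm_triangle_ineq4[of "v (t + \<eta>)" "v t"] by linarith
    qed
    moreover have "(K * \<eta>) * \<eta> < e / 2 * \<eta>"
      using \<eta> by (intro mult_strict_right_mono) auto
    moreover have "norm (v t) < e / 4 * \<eta>" "norm (v (t + \<eta>)) < e / 4 * \<eta>"
      using T[of t] T[of "t + \<eta>"] elim \<eta> by auto
    ultimately have "norm (\<eta> *\<^sub>R w t) < \<eta> * e"
      by argo
    thus ?case
      using \<eta> by simp
  qed
qed

text \<open>The partial integrals \<open>J\<close> increase. Since \<open>J + V\<close> decreases
  and \<open>V\<close> is nonnegative, they stay below \<open>V 0\<close>; monotone convergence of
  \<open>J\<close> then gives the improper integral.\<close>

lemma dissipation_integrable:
  fixes V g :: "real \<Rightarrow> real"
  assumes deriv: "\<And>t. t \<ge> 0 \<Longrightarrow> (V has_real_derivative V' t) (at t within {0..})"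
    and diss: "\<And>t. t \<ge> 0 \<Longrightarrow> g t \<le> - V' t"
    and V: "\<And>t. t \<ge> 0 \<Longrightarrow> V t \<ge> 0" and g: "\<And>t. t \<ge> 0 \<Longrightarrow> g t \<ge> 0"
    and cont: "continuous_on {0..} g"
  shows "integrable (lebesgue_on {0<..}) g"
proof -
  define J where "J t = integral {0..t} g" for t
  have int: "g integrable_on {0..t}" for t
    by (intro integrable_continuous_real continuous_on_subset[OF cont]) auto
  have J_deriv: "(J has_real_derivative g t) (at t within {0..})" if "t \<ge> 0" for t
    using integral_has_vector_derivative_half_line[OF cont that]
    by (simp add: J_def[abs_def] has_real_derivative_iff_has_vector_derivative)
  have J_anti: "- J t \<le> - J s" if "0 \<le> s" "s \<le> t" for s t
    using that g
    by (intro has_real_derivative_within_nonpos_antimono[OF _ _ DERIV_minus[OF J_deriv]]) auto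
  have J_le: "- V 0 \<le> - J t" if "0 \<le> t" for t
  proof -
    have "J t + V t \<le> J 0 + V 0"
      using that
      by (intro has_real_derivative_within_nonpos_antimono[OF _ _ DERIV_add[OF J_deriv deriv]])
         (use diss in \<open>fastforce+\<close>)
    thus ?thesis
      using V[OF that] by (simp add: J_def)
  qed
  obtain l where "((\<lambda>t. - J t) \<longlongrightarrow> l) at_top"
    using antimono_bounded_below_tendsto[of 0 "\<lambda>t. - J t" "- V 0"] J_anti J_le by blast
  hence "(J \<longlongrightarrow> - l) at_top"
    using tendsto_minus by fastforce
  hence "(g has_integral - l) {0..}"
    unfolding J_def by (rule has_integral_to_inf[OF int]) (rule g)
  hence "g absolutely_integrable_on {0..}"
    using g by (intro nonnegative_absolutely_integrable_1) auto
  hence "g absolutely_integrable_on {0<..}"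
    by (rule set_integrable_subset) auto
  thus ?thesis
    by (rule absolutely_integrable_imp_integrable) auto
qed

text \<open>The time variable is discretised instead of the values: a composition of
  \<open>f\<close> with a finitely valued measurable function of time is simple whatever the target
  space, so separability never enters.\<close>

lemma strongly_measurable_continuous_half_line:
  fixes f :: "real \<Rightarrow> 'a::real_normed_vector"
  assumes cont: "continuous_on {0..} f"
  shows "strongly_measurable (lebesgue_on {0<..}) f"
proof -
  \<comment> \<open>Time is capped at \<open>n\<close> and rounded down to the grid of mesh
    \<open>1 / Suc n\<close>. The cap makes the range finite, and for positive \<open>x\<close> the
    rounded time stays in the closed half-line, where \<open>f\<close> is continuous.\<close>
  define k where "k n x = real_of_int \<lfloor>real (Suc n) * min (real n) x\<rfloor> / real (Suc n)" for n x
  have simple: "simple_function (lebesgue_on {0<..}) (k n)" for n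
  proof (rule simple_function_borel_measurable)
    have "k n \<in> borel_measurable borel"
      unfolding k_def by measurable
    thus "k n \<in> borel_measurable (lebesgue_on {0<..})"
      by (simp add: measurable_completion measurable_restrict_space1)
    have "k n ` {0<..} \<subseteq> (\<lambda>i. real_of_int i / real (Suc n)) ` {0..int (Suc n) * int n}"
    proof
      fix y assume "y \<in> k n ` {0<..}"
      then obtain x where x: "x > 0" "y = k n x"
        by auto
      have "real (Suc n) * min (real n) x \<le> real (Suc n) * real n"
        by (intro mult_left_mono) auto
      also have "\<dots> = real_of_int (int (Suc n) * int n)"
        by simp
      finally have "\<lfloor>real (Suc n) * min (real n) x\<rfloor> \<le> int (Suc n) * int n"
        by linarith
      moreover have "0 \<le> \<lfloor>real (Suc n) * min (real n) x\<rfloor>"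
        using x by simp
      ultimately show "y \<in> (\<lambda>i. real_of_int i / real (Suc n)) ` {0..int (Suc n) * int n}"
        unfolding x k_def by (intro imageI) simp
    qed
    thus "finite (k n ` space (lebesgue_on {0<..}))"
      by (simp only: space_lebesgue_on) (rule finite_subset, auto)
  qed
  have "(\<lambda>n. f (k n x)) \<longlonglongrightarrow> f x" if x: "x > 0" for x
  proof -
    have "(\<lambda>n. k n x) \<longlonglongrightarrow> x"
    proof (rule real_tendsto_sandwich)
      have "\<forall>\<^sub>F n in sequentially. real n \<ge> x"
        by (meson eventually_sequentiallyI nat_ceiling_le_eq)
      thus "\<forall>\<^sub>F n in sequentially. x - 1 / real (Suc n) \<le> k n x"
      proof eventually_elim
        case (elim n)
        have "real (Suc n) * x - 1 \<le> real_of_int \<lfloor>real (Suc n) * x\<rfloor>"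
          by linarith
        hence "(real (Suc n) * x - 1) / real (Suc n) \<le> real_of_int \<lfloor>real (Suc n) * x\<rfloor> / real (Suc n)"
          by (intro divide_right_mono) auto
        thus ?case
          using elim by (simp add: k_def diff_divide_distrib min_absorb2)
      qed
      show "\<forall>\<^sub>F n in sequentially. k n x \<le> x"
      proof (intro always_eventually allI)
        fix n
        have "k n x \<le> real (Suc n) * min (real n) x / real (Suc n)"
          unfolding k_def by (intro divide_right_mono) auto
        thus "k n x \<le> x"
          by simp
      qed
      have "(\<lambda>n. x - 1 / real (Suc n)) \<longlonglongrightarrow> x - 0"
        by (intro tendsto_intros lim_1_over_n[THEN LIMSEQ_Suc])
      thus "(\<lambda>n. x - 1 / real (Suc n)) \<longlonglongrightarrow> x"
        by simp
    qed simp
    moreover have "k n x \<in> {0..}" for n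
      using x by (simp add: k_def)
    ultimately show ?thesis
      using x by (intro continuous_on_tendsto_compose[OF cont]) auto
  qed
  hence "AE x in lebesgue_on {0<..}. (\<lambda>n. f (k n x)) \<longlonglongrightarrow> f x"
    by (intro AE_I2) simp
  moreover have "simple_function (lebesgue_on {0<..}) (\<lambda>x. f (k n x))" for n
    using simple by (rule simple_function_compose1)
  ultimately show ?thesis
    unfolding strongly_measurable_def by (intro exI[of _ "\<lambda>n x. f (k n x)"] conjI allI)
qed

lemma in_L2_half_lineI:
  fixes f :: "real \<Rightarrow> 'a::real_normed_vector" and V :: "real \<Rightarrow> real"
  assumes deriv: "\<And>t. t \<ge> 0 \<Longrightarrow> (V has_real_derivative V' t) (at t within {0..})"
    and "\<And>t. t \<ge> 0 \<Longrightarrow> (norm (f t))\<^sup>2 \<le> C * - V' t"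
    and "\<And>t. t \<ge> 0 \<Longrightarrow> V t \<ge> 0" "C \<ge> 0"
    and cont: "continuous_on {0..} f"
  shows "in_L2_half_line f"
  unfolding in_L2_half_line_def
proof
  show "integrable (lebesgue_on {0<..}) (\<lambda>t. (norm (f t))\<^sup>2)"
    using assms
    by (intro dissipation_integrable[where V = "\<lambda>t. C * V t" and V' = "\<lambda>t. C * V' t"] DERIV_cmult)
       (auto intro!: continuous_intros)
qed (rule strongly_measurable_continuous_half_line[OF cont])

lemma in_L2_half_line_cong:
  assumes "\<And>t. t > 0 \<Longrightarrow> f t = g t"
  shows "in_L2_half_line f \<longleftrightarrow> in_L2_half_line g"
proof -
  have "strongly_measurable (lebesgue_on {0<..}) f = strongly_measurable (lebesgue_on {0<..}) g"
    unfolding strongly_measurable_def by (intro ex_cong1 conj_cong refl AE_cong) (simp add: assms)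
  moreover have "integrable (lebesgue_on {0<..}) (\<lambda>t. (norm (f t))\<^sup>2) =
      integrable (lebesgue_on {0<..}) (\<lambda>t. (norm (g t))\<^sup>2)"
    by (intro Bochner_Integration.integrable_cong) (simp_all add: assms)
  ultimately show ?thesis
    by (simp add: in_L2_half_line_def)
qed

subsection \<open>Weak convergence and monotone operators\<close>

text \<open>The distances \<open>d n\<close> from the origin increase to a finite limit
  \<open>\<delta>\<close>. Points of \<open>C n\<close> with norm at most \<open>r n\<close> have
  their midpoint in \<open>C n\<close>, of norm at least \<open>d n\<close>, so the parallelogram
  identity bounds their squared distance by \<open>4 * ((r n)\<^sup>2 - (d n)\<^sup>2)\<close>. The
  diameters shrink to 0 and Cantor's intersection theorem applies. This takes the place of weak
  compactness.\<close>

lemma nested_convex_bounded_Inter_nonempty: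
  fixes C :: "nat \<Rightarrow> 'h::{real_inner, complete_space} set"
  assumes cl: "\<And>n. closed (C n)" and cv: "\<And>n. convex (C n)" and ne: "\<And>n. C n \<noteq> {}"
    and dec: "\<And>m n. m \<le> n \<Longrightarrow> C n \<subseteq> C m" and bd: "bounded (C 0)"
  shows "(\<Inter>n. C n) \<noteq> {}"
proof -
  obtain K where K: "norm x \<le> K" if "x \<in> C 0" for x
    using bd by (auto simp: bounded_iff)
  define d where "d n = infdist 0 (C n)" for n
  have d_le: "d n \<le> norm x" if "x \<in> C n" for n x
    using infdist_le[OF that, of 0] by (simp add: d_def)
  have d_nonneg: "d n \<ge> 0" for n
    by (simp add: d_def infdist_nonneg)
  have "incseq d"
    unfolding d_def by (intro incseq_SucI infdist_mono dec ne) simp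
  moreover have "\<forall>n. d n \<le> K"
    using ne K d_le dec[OF le0] by (metis all_not_in_conv order_trans subsetD)
  ultimately obtain \<delta> where \<delta>: "d \<longlonglongrightarrow> \<delta>" "\<forall>n. d n \<le> \<delta>"
    by (rule incseq_convergent)
  \<comment> \<open>The radius strictly exceeds \<open>d n\<close>, so the ball meets
    \<open>C n\<close> even before a point of minimal norm is known to exist; it decreases, so the
    intersections stay nested.\<close>
  define r where "r n = \<delta> + 1 / real (Suc n)" for n
  have "r \<longlonglongrightarrow> \<delta> + 0"
    unfolding r_def by (intro tendsto_intros lim_1_over_n[THEN LIMSEQ_Suc])
  hence r: "r \<longlonglongrightarrow> \<delta>"
    by simp
  have "\<exists>a. (\<Inter>n. C n \<inter> cball 0 (r n)) = {a}"
  proof (rule decreasing_closed_nest_sing)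
    show "closed (C n \<inter> cball 0 (r n))" for n
      by (intro closed_Int cl closed_cball)
    show "C n \<inter> cball 0 (r n) \<noteq> {}" for n
    proof -
      have "d n < r n"
        using \<delta>(2)[rule_format, of n] by (simp add: r_def add_pos_pos le_less_trans[of "d n" \<delta>])
      then obtain x where "x \<in> C n" "norm x < r n"
        using cINF_less_iff[OF ne[of n] bdd_below_image_dist, of 0 "r n"] ne[of n]
        by (auto simp: d_def infdist_def)
      thus ?thesis
        by auto
    qed
    show "C n \<inter> cball 0 (r n) \<subseteq> C m \<inter> cball 0 (r m)" if "m \<le> n" for m n
    proof -
      have "r n \<le> r m"
        using that by (auto simp: r_def intro!: divide_left_mono)
      thus ?thesis
        using dec[OF that] by auto
    qed
    fix \<epsilon> :: real assume "\<epsilon> > 0"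
    have "(\<lambda>n. 4 * ((r n)\<^sup>2 - (d n)\<^sup>2)) \<longlonglongrightarrow> 4 * (\<delta>\<^sup>2 - \<delta>\<^sup>2)"
      by (intro tendsto_intros r \<delta>)
    hence "\<forall>\<^sub>F n in sequentially. 4 * ((r n)\<^sup>2 - (d n)\<^sup>2) < \<epsilon>\<^sup>2"
      using \<open>\<epsilon> > 0\<close> by (intro order_tendstoD) auto
    then obtain n where n: "4 * ((r n)\<^sup>2 - (d n)\<^sup>2) < \<epsilon>\<^sup>2"
      by (auto simp: eventually_sequentially)
    show "\<exists>n. \<forall>x\<in>C n \<inter> cball 0 (r n). \<forall>y\<in>C n \<inter> cball 0 (r n). dist x y < \<epsilon>"
    proof (intro exI ballI)
      fix x y assume "x \<in> C n \<inter> cball 0 (r n)" "y \<in> C n \<inter> cball 0 (r n)"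
      hence xy: "x \<in> C n" "y \<in> C n" "norm x \<le> r n" "norm y \<le> r n"
        by auto
      have "(1/2) *\<^sub>R x + (1/2) *\<^sub>R y \<in> C n"
        using cv[of n] xy by (auto simp: convex_def)
      hence "d n \<le> norm (midpoint x y)"
        unfolding midpoint_def by (intro d_le) (simp add: scaleR_add_right inverse_eq_divide)
      hence "(d n)\<^sup>2 \<le> (norm (midpoint x y))\<^sup>2"
        using d_nonneg by (intro power_mono) auto
      moreover have "(dist x y)\<^sup>2 = 2 * (norm x)\<^sup>2 + 2 * (norm y)\<^sup>2 - 4 * (norm (midpoint x y))\<^sup>2"
        by (simp add: dist_norm midpoint_def power2_norm_eq_inner inner_simps inner_commute field_simps)
      moreover have "(norm x)\<^sup>2 \<le> (r n)\<^sup>2" "(norm y)\<^sup>2 \<le> (r n)\<^sup>2"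
        using xy by (auto intro!: power_mono)
      ultimately have "(dist x y)\<^sup>2 < \<epsilon>\<^sup>2"
        using n by argo
      thus "dist x y < \<epsilon>"
        using \<open>\<epsilon> > 0\<close> by (simp add: power_less_imp_less_base)
    qed
  qed
  thus ?thesis
    by blast
qed

text \<open>The closed convex hulls of the tails of a trajectory play the role of its weak cluster
  points; this avoids weak sequential compactness.\<close>

definition tail_hulls :: "(real \<Rightarrow> 'h::real_inner) \<Rightarrow> 'h set" where
  "tail_hulls u = (\<Inter>n. closure (convex hull (u ` {real n..})))"

lemma closed_convex_hull_inner_ge:
  assumes "\<And>x. x \<in> X \<Longrightarrow> c \<le> inner x z" "x \<in> closure (convex hull X)"
  shows "c \<le> inner x z"
proof -
  have "closure (convex hull X) \<subseteq> {x. c \<le> inner z x}"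
    using assms(1)
    by (intro closure_minimal hull_minimal convex_halfspace_ge closed_halfspace_ge)
       (auto simp: inner_commute)
  thus ?thesis
    using assms(2) by (auto simp: inner_commute)
qed

lemma tail_hulls_inner_ge:
  assumes "x \<in> tail_hulls u" and ev: "\<forall>\<^sub>F t in at_top. c \<le> inner (u t) z"
  shows "c \<le> inner x z"
proof -
  obtain T where T: "c \<le> inner (u t) z" if "t \<ge> T" for t
    using ev by (auto simp: eventually_at_top_linorder)
  obtain n where n: "T \<le> real n"
    using real_arch_simple by blast
  have "x \<in> closure (convex hull (u ` {real n..}))"
    using \<open>x \<in> tail_hulls u\<close> by (auto simp: tail_hulls_def)
  thus ?thesis
    by (rule closed_convex_hull_inner_ge[rotated]) (use T n in auto)
qed

lemma tail_hulls_inner_eq: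
  assumes "x \<in> tail_hulls u" and lim: "((\<lambda>t. inner (u t) z) \<longlongrightarrow> l) at_top"
  shows "inner x z = l"
proof (rule antisym)
  show "inner x z \<le> l"
  proof (rule field_le_epsilon)
    fix e :: real assume "e > 0"
    hence "\<forall>\<^sub>F t in at_top. inner (u t) z < l + e"
      using order_tendstoD(2)[OF lim] by simp
    hence "\<forall>\<^sub>F t in at_top. - (l + e) \<le> inner (u t) (- z)"
      by eventually_elim simp
    from tail_hulls_inner_ge[OF assms(1) this] show "inner x z \<le> l + e"
      by simp
  qed
  show "l \<le> inner x z"
  proof (rule field_le_epsilon)
    fix e :: real assume "e > 0"
    hence "\<forall>\<^sub>F t in at_top. l - e < inner (u t) z"
      using order_tendstoD(1)[OF lim] by simp
    hence "\<forall>\<^sub>F t in at_top. l - e \<le> inner (u t) z"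
      by eventually_elim simp
    from tail_hulls_inner_ge[OF assms(1) this] show "l \<le> inner x z + e"
      by simp
  qed
qed

text \<open>This replaces the extraction of a weakly convergent subsequence. Only the late points
  lying in the half-space are kept; their closed convex hulls are nonempty, nested and bounded, and
  remain inside the half-space.\<close>

lemma frequently_inner_ge_tail_hulls:
  fixes u :: "real \<Rightarrow> 'h::{real_inner, complete_space}"
  assumes bd: "bounded (u ` {0..})" and freq: "\<exists>\<^sub>F t in at_top. c \<le> inner (u t) z"
  obtains x where "x \<in> tail_hulls u" "c \<le> inner x z"
proof -
  define X where "X n = {t. real n \<le> t \<and> c \<le> inner (u t) z}" for n
  define C where "C n = closure (convex hull (u ` X n))" for n
  have "(\<Inter>n. C n) \<noteq> {}"
  proof (rule nested_convex_bounded_Inter_nonempty)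
    show "C n \<noteq> {}" for n
    proof -
      have "X n \<noteq> {}"
        using freq by (force simp: X_def frequently_def eventually_at_top_linorder)
      thus ?thesis
        by (simp add: C_def)
    qed
    show "C n \<subseteq> C m" if "m \<le> n" for m n
      unfolding C_def using that by (intro closure_mono hull_mono image_mono) (auto simp: X_def)
    have "bounded (u ` X 0)"
      by (rule bounded_subset[OF bd]) (auto simp: X_def)
    thus "bounded (C 0)"
      unfolding C_def by (intro bounded_closure bounded_convex_hull)
  qed (auto simp: C_def intro!: convex_closure convex_convex_hull)
  then obtain x where x: "x \<in> C n" for n
    by blast
  have "C n \<subseteq> closure (convex hull (u ` {real n..}))" for n
    unfolding C_def by (intro closure_mono hull_mono image_mono) (auto simp: X_def)
  hence "x \<in> tail_hulls u"
    using x by (auto simp: tail_hulls_def)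
  moreover have "c \<le> inner x z"
    by (rule closed_convex_hull_inner_ge[OF _ x[of 0, unfolded C_def]]) (auto simp: X_def)
  ultimately show ?thesis
    by (rule that)
qed

text \<open>Minty's trick: test the variational inequality at \<open>x - s f(x)\<close> and let \<open>s\<close> tend to 0.\<close>

lemma minty_zero:
  fixes f :: "'h::real_inner \<Rightarrow> 'h"
  assumes cont: "continuous_on UNIV f" and var: "\<And>y. 0 \<le> inner (f y) (y - x)"
  shows "f x = 0"
proof -
  have "((\<lambda>s. inner (f (x - s *\<^sub>R f x)) (f x)) \<longlongrightarrow> inner (f (x - 0 *\<^sub>R f x)) (f x)) (at_right 0)"
    by (intro tendsto_intros continuous_on_tendsto_compose[OF cont]) auto
  moreover have "\<forall>\<^sub>F s in at_right 0. inner (f (x - s *\<^sub>R f x)) (f x) \<le> 0"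
  proof (rule eventually_at_right_less[THEN eventually_mono])
    fix s :: real assume "0 < s"
    thus "inner (f (x - s *\<^sub>R f x)) (f x) \<le> 0"
      using var[of "x - s *\<^sub>R f x"] by (simp add: mult_le_0_iff)
  qed
  ultimately have "inner (f (x - 0 *\<^sub>R f x)) (f x) \<le> 0"
    by (rule tendsto_upperbound) simp
  hence "norm (f x) ^ 2 \<le> 0"
    by (simp add: power2_norm_eq_inner)
  thus ?thesis
    by simp
qed

text \<open>Opial's argument on \<open>tail_hulls u\<close>: all its points are zeros of
  \<open>f\<close> by Minty's trick, two of them coincide because the distances to both converge,
  and it is nonempty. With a single candidate left, failure of weak convergence would put a
  different point into \<open>tail_hulls u\<close>.\<close>

lemma weakly_tendsto_zero_of_monotone:
  fixes u :: "real \<Rightarrow> 'h::{real_inner, complete_space}" and f :: "'h \<Rightarrow> 'h"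
  assumes bd: "bounded (u ` {0..})" and cont: "continuous_on UNIV f"
    and mono: "\<And>x y. 0 \<le> inner (f x - f y) (x - y)"
    and lim: "((\<lambda>t. f (u t)) \<longlongrightarrow> 0) at_top"
    and dist_lim: "\<And>p. f p = 0 \<Longrightarrow> \<exists>l. ((\<lambda>t. norm (u t - p)) \<longlongrightarrow> l) at_top"
  obtains x where "f x = 0" "weakly_tendsto u x at_top"
proof -
  obtain K where K: "norm (u t) \<le> K" if "t \<ge> 0" for t
    using bd by (auto simp: bounded_iff)
  have zero: "f x = 0" if x: "x \<in> tail_hulls u" for x
  proof (rule minty_zero[OF cont])
    fix y :: 'h
    have "((\<lambda>t. norm (f (u t)) * (norm y + K)) \<longlongrightarrow> norm (0 :: 'h) * (norm y + K)) at_top"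
      by (intro tendsto_intros lim)
    hence small: "((\<lambda>t. norm (f (u t)) * (norm y + K)) \<longlongrightarrow> 0) at_top"
      by simp
    show "0 \<le> inner (f y) (y - x)"
    proof (rule field_le_epsilon)
      \<comment> \<open>Monotonicity bounds the pairing of \<open>f y\<close> with
        \<open>y - u t\<close> below by that of \<open>f (u t)\<close> with \<open>y - u t\<close>,
        which is eventually above \<open>- e\<close>. The resulting inequality is affine in
        \<open>u t\<close>, so it passes to \<open>tail_hulls\<close>.\<close>
      fix e :: real assume "e > 0"
      have "\<forall>\<^sub>F t in at_top. inner (- f y) y - e \<le> inner (u t) (- f y)"
        using order_tendstoD(2)[OF small \<open>e > 0\<close>] eventually_ge_at_top[of 0]
      proof eventually_elim
        case (elim t)
        have "inner (f (u t)) (u t - y) \<le> norm (f (u t)) * norm (u t - y)"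
          by (rule norm_cauchy_schwarz)
        also have "norm (u t - y) \<le> norm y + K"
          using norm_triangle_ineq4[of "u t" y] K[of t] elim by linarith
        finally have "inner (f (u t)) (u t - y) < e"
          using elim by (simp add: mult_left_mono)
        thus ?case
          using mono[of y "u t"] by (simp add: inner_simps inner_commute)
      qed
      from tail_hulls_inner_ge[OF x this] show "0 \<le> inner (f y) (y - x) + e"
        by (simp add: inner_simps inner_commute)
    qed
  qed
  have unique: "x = y" if xy: "x \<in> tail_hulls u" "y \<in> tail_hulls u" for x y
  proof -
    obtain l m where lm: "((\<lambda>t. norm (u t - x)) \<longlongrightarrow> l) at_top" "((\<lambda>t. norm (u t - y)) \<longlongrightarrow> m) at_top"
      using dist_lim[OF zero[OF xy(1)]] dist_lim[OF zero[OF xy(2)]] by (elim exE)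
    \<comment> \<open>In the difference of the two squared distances the term quadratic in
      \<open>u t\<close> cancels, so their limits determine the limit of a linear functional of
      \<open>u t\<close>.\<close>
    have eq: "inner (u t) (x - y) = (norm (u t - y) ^ 2 - norm (u t - x) ^ 2 + norm x ^ 2 - norm y ^ 2) / 2" for t
      by (simp add: power2_norm_eq_inner inner_simps inner_commute)
    have "((\<lambda>t. inner (u t) (x - y)) \<longlongrightarrow> (m ^ 2 - l ^ 2 + norm x ^ 2 - norm y ^ 2) / 2) at_top"
      unfolding eq by (intro tendsto_intros lm) simp
    hence "inner x (x - y) = inner y (x - y)"
      using tail_hulls_inner_eq that by metis
    hence "inner (x - y) (x - y) = 0"
      by (simp add: inner_diff_left)
    thus ?thesis
      by simp
  qed
  \<comment> \<open>With \<open>c\<close> and \<open>z\<close> both 0 the half-space condition is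
    trivial, and only nonemptiness is extracted.\<close>
  obtain x where x: "x \<in> tail_hulls u"
    using frequently_inner_ge_tail_hulls[OF bd, of 0 0] by auto
  have "((\<lambda>t. inner (u t) y) \<longlongrightarrow> inner x y) at_top" for y
  \<comment> \<open>If one of the two bounds fails, the trajectory visits the opposite half-space at
    arbitrarily late times, which yields a point of \<open>tail_hulls u\<close> separated from
    \<open>x\<close>.\<close>
  proof (rule order_tendstoI; rule ccontr)
    fix a assume a: "a < inner x y" "\<not> (\<forall>\<^sub>F t in at_top. a < inner (u t) y)"
    hence "\<exists>\<^sub>F t in at_top. - a \<le> inner (u t) (- y)"
      by (simp add: not_eventually not_less)
    then obtain x' where "x' \<in> tail_hulls u" "- a \<le> inner x' (- y)"
      using frequently_inner_ge_tail_hulls[OF bd] by blast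
    thus False
      using unique[OF x] a by fastforce
  next
    fix a assume a: "inner x y < a" "\<not> (\<forall>\<^sub>F t in at_top. inner (u t) y < a)"
    hence "\<exists>\<^sub>F t in at_top. a \<le> inner (u t) y"
      by (simp add: not_eventually not_less)
    then obtain x' where "x' \<in> tail_hulls u" "a \<le> inner x' y"
      using frequently_inner_ge_tail_hulls[OF bd] by blast
    thus False
      using unique[OF x] a by fastforce
  qed
  thus ?thesis
    using that zero[OF x] by (simp add: weakly_tendsto_def)
qed

subsection \<open>The damped system\<close>

definition ball_retraction :: "real \<Rightarrow> 'h::real_inner \<Rightarrow> 'h" where
  "ball_retraction R x = (if norm x \<le> R then x else (R / norm x) *\<^sub>R x)"

lemma ball_retraction_eq: "norm x \<le> R \<Longrightarrow> ball_retraction R x = x"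
  by (simp add: ball_retraction_def)

lemma norm_ball_retraction_le: "R \<ge> 0 \<Longrightarrow> norm (ball_retraction R x) \<le> R"
  by (simp add: ball_retraction_def)

lemma ball_retraction_variational:
  assumes "R \<ge> 0" "norm z \<le> R"
  shows "0 \<le> inner (ball_retraction R x - z) (x - ball_retraction R x)"
proof (cases "norm x \<le> R")
  case False
  define s where "s = R / norm x"
  have s: "0 \<le> s" "s \<le> 1" "s * norm x = R"
    using False assms by (auto simp: s_def divide_le_eq_1)
  have "inner z x \<le> R * norm x"
    using norm_cauchy_schwarz[of z x] mult_right_mono[OF assms(2), of "norm x"] by simp
  also have "\<dots> = inner (s *\<^sub>R x) x"
    using s by (simp add: power2_norm_eq_inner[symmetric] power2_eq_square)
  finally have "0 \<le> (1 - s) * inner (s *\<^sub>R x - z) x"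
    using s by (simp add: inner_diff_left)
  moreover have "x - s *\<^sub>R x = (1 - s) *\<^sub>R x"
    by (simp add: algebra_simps)
  ultimately show ?thesis
    using False by (simp add: ball_retraction_def flip: s_def)
qed (simp add: ball_retraction_def)

text \<open>Adding the variational inequalities at the two projections gives firm nonexpansiveness,
  and Cauchy-Schwarz gives the constant 1. Composing a field with this map makes a Lipschitz
  constant on the ball global.\<close>

lemma ball_retraction_lipschitz:
  assumes "R \<ge> 0"
  shows "1-lipschitz_on UNIV (ball_retraction R :: 'h::real_inner \<Rightarrow> 'h)"
proof (rule lipschitz_onI)
  fix x y :: 'h
  define a b where "a = ball_retraction R x" and "b = ball_retraction R y"
  have "0 \<le> inner (a - b) (x - a)" "0 \<le> inner (b - a) (y - b)"
    unfolding a_def b_def using assms by (auto intro!: ball_retraction_variational norm_ball_retraction_le)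
  hence "(norm (a - b))\<^sup>2 \<le> inner (a - b) (x - y)"
    by (simp add: power2_norm_eq_inner inner_simps inner_commute)
  also have "\<dots> \<le> norm (a - b) * norm (x - y)"
    by (rule norm_cauchy_schwarz)
  finally show "dist (ball_retraction R x) (ball_retraction R y) \<le> 1 * dist x y"
    by (cases "a = b") (auto simp: power2_eq_square dist_norm a_def b_def)
qed simp

lemma power2_norm_add_scaleR:
  fixes a b :: "'h::real_inner"
  shows "(norm (a + c *\<^sub>R b))\<^sup>2 = (norm a)\<^sup>2 + 2 * c * inner a b + c\<^sup>2 * (norm b)\<^sup>2"
  unfolding power2_norm_eq_inner
  by (simp add: inner_add_left inner_add_right inner_commute[of b a] power2_eq_square distrib_left)

locale damped_system =
  fixes \<phi> :: "'h::{real_inner, complete_space} \<Rightarrow> real" and B A :: "'h \<Rightarrow> 'h" and lam \<gamma> :: real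
  assumes convex: "convex_on UNIV \<phi>"
    and gradient: "\<And>x. GDERIV \<phi> x :> B x"
    and gradient_lipschitz: "\<And>X. bounded X \<Longrightarrow> \<exists>L. L-lipschitz_on X B"
    and cocoercive: "cocoercive lam A"
    and damping_pos: "\<gamma> > 0"
    and damping_large: "lam * \<gamma>\<^sup>2 > 1"
begin

definition field :: "'h \<Rightarrow> 'h" where
  "field x = B x + A x"

text \<open>The velocity is a separate argument, so that differentiation rules apply to the
  phase-space pair directly; \<open>time_deriv\<close> enters only when flows are compared with
  solutions.\<close>

definition flow_on :: "real set \<Rightarrow> (real \<Rightarrow> 'h) \<Rightarrow> (real \<Rightarrow> 'h) \<Rightarrow> bool" where
  "flow_on T u v \<longleftrightarrow>
     (\<forall>t\<in>T. (u has_vector_derivative v t) (at t within T) \<and>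
            (v has_vector_derivative - (\<gamma> *\<^sub>R v t) - field (u t)) (at t within T))"

section \<open>Convexity, monotonicity and Lipschitz bounds for the field\<close>

lemma lam_pos: "lam > 0"
  using cocoercive by (simp add: cocoercive_def)

lemma cocoerciveD: "lam * (norm (A x - A y))\<^sup>2 \<le> inner (A x - A y) (x - y)"
  using cocoercive by (simp add: cocoercive_def)

lemma potential_has_derivative: "(\<phi> has_derivative (\<lambda>h. inner h (B x))) (at x within X)"
  using gradient[of x] unfolding gderiv_def by (rule has_derivative_at_withinI)

lemma potential_ge_tangent: "\<phi> x + inner (B x) (y - x) \<le> \<phi> y"
proof -
  define g where "g s = \<phi> (x + s *\<^sub>R (y - x))" for s :: real
  have "((\<lambda>s. x + s *\<^sub>R (y - x)) has_derivative (\<lambda>h. h *\<^sub>R (y - x))) (at 0)"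
    by (auto intro!: derivative_eq_intros)
  hence "(g has_derivative (\<lambda>h. inner (h *\<^sub>R (y - x)) (B x))) (at 0)"
    unfolding g_def[abs_def] using has_derivative_compose[OF _ potential_has_derivative] by fastforce
  hence "(g has_real_derivative inner (B x) (y - x)) (at 0)"
    by (rule has_derivative_imp_has_field_derivative) (simp add: inner_commute)
  hence "((\<lambda>s. (g s - g 0) / (s - 0)) \<longlongrightarrow> inner (B x) (y - x)) (at 0)"
    by (simp add: has_field_derivative_iff)
  hence lim: "((\<lambda>s. (g s - g 0) / (s - 0)) \<longlongrightarrow> inner (B x) (y - x)) (at_right 0)"
    by (rule filterlim_mono) (auto intro: at_le)
  have "\<forall>\<^sub>F s in at_right (0::real). s \<in> {0<..<1}"
    by (rule eventually_at_right_real) simp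
  hence "\<forall>\<^sub>F s in at_right 0. (g s - g 0) / (s - 0) \<le> \<phi> y - \<phi> x"
  proof eventually_elim
    case (elim s)
    have "g s = \<phi> ((1 - s) *\<^sub>R x + s *\<^sub>R y)"
      by (simp add: g_def algebra_simps)
    also have "\<dots> \<le> (1 - s) * \<phi> x + s * \<phi> y"
      using elim by (intro convex_onD[OF convex]) auto
    finally show ?case
      using elim by (simp add: g_def divide_simps algebra_simps)
  qed
  from tendsto_upperbound[OF lim this] show ?thesis
    by simp
qed

lemma gradient_monotone: "0 \<le> inner (B x - B y) (x - y)"
  using potential_ge_tangent[of x y] potential_ge_tangent[of y x] by (simp add: inner_simps)

lemma field_monotone: "0 \<le> inner (field x - field y) (x - y)"
proof -
  have "0 \<le> lam * (norm (A x - A y))\<^sup>2"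
    using lam_pos by simp
  hence "0 \<le> inner (A x - A y) (x - y)"
    using cocoerciveD[of x y] by linarith
  thus ?thesis
    using gradient_monotone[of x y] by (simp add: field_def inner_simps)
qed

lemma A_lipschitz: "(1 / lam)-lipschitz_on X A"
proof (rule lipschitz_onI)
  fix x y
  have "lam * norm (A x - A y) * norm (A x - A y) \<le> norm (x - y) * norm (A x - A y)"
    using cocoerciveD[of x y] norm_cauchy_schwarz[of "A x - A y" "x - y"]
    by (simp add: power2_eq_square mult_ac)
  hence "lam * norm (A x - A y) \<le> norm (x - y)"
    by (cases "A x = A y") (auto dest: mult_right_le_imp_le)
  thus "dist (A x) (A y) \<le> 1 / lam * dist x y"
    using lam_pos by (simp add: dist_norm field_simps)
qed (use lam_pos in simp)

lemma field_lipschitz: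
  assumes "bounded X"
  shows "\<exists>L. L-lipschitz_on X field"
proof -
  obtain L where "L-lipschitz_on X B"
    using gradient_lipschitz[OF assms] ..
  from lipschitz_on_add[OF this A_lipschitz] show ?thesis
    unfolding field_def[abs_def] ..
qed

lemma continuous_on_locally_lipschitz:
  assumes "\<And>X. bounded X \<Longrightarrow> \<exists>L. L-lipschitz_on X g"
  shows "continuous_on UNIV (g :: 'h \<Rightarrow> 'h)"
proof -
  have "continuous_on (ball x 1) g" for x
    using assms[OF bounded_ball] lipschitz_on_continuous_on by blast
  hence "isCont g x" for x
    by (metis centre_in_ball continuous_on_eq_continuous_at open_ball zero_less_one)
  thus ?thesis
    by (simp add: continuous_on_eq_continuous_within)
qed

lemma field_continuous: "continuous_on X field"
  using continuous_on_locally_lipschitz[OF field_lipschitz] continuous_on_subset by blast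

text \<open>The weight \<open>2 / \<gamma>\<close> of the energy is chosen so that the dissipation is a definite
  quadratic form in \<open>v\<close> and \<open>A x - A p\<close> exactly when \<open>lam * \<gamma>\<^sup>2 > 1\<close>.\<close>

definition lyap :: "'h \<Rightarrow> 'h \<Rightarrow> 'h \<Rightarrow> real" where
  "lyap p x v = inner (x - p) v + \<gamma> / 2 * (norm (x - p))\<^sup>2 +
     2 / \<gamma> * ((norm v)\<^sup>2 / 2 + \<phi> x - \<phi> p - inner (B p) (x - p))"

definition lyap_rate :: "'h \<Rightarrow> 'h \<Rightarrow> 'h \<Rightarrow> real" where
  "lyap_rate p x v = - (norm v)\<^sup>2 - inner (field x) (x - p) - 2 / \<gamma> * inner (A x - A p) v"

text \<open>The potential part is a Bregman distance of the convex function \<open>\<phi>\<close>,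
  hence nonnegative. The remaining quadratic form in \<open>x - p\<close> and \<open>v\<close> is
  bounded below by completing the square, once in \<open>v\<close> and once in
  \<open>x - p\<close>.\<close>

lemma lyap_lower_bounds:
  shows "\<gamma> / 4 * (norm (x - p))\<^sup>2 \<le> lyap p x v" and "1 / (2 * \<gamma>) * (norm v)\<^sup>2 \<le> lyap p x v"
proof -
  have "0 \<le> 2 / \<gamma> * (\<phi> x - \<phi> p - inner (B p) (x - p))"
    using potential_ge_tangent[of p x] damping_pos by simp
  moreover have "lyap p x v =
      inner (x - p) v + \<gamma> / 2 * (norm (x - p))\<^sup>2 + (norm v)\<^sup>2 / \<gamma> +
      2 / \<gamma> * (\<phi> x - \<phi> p - inner (B p) (x - p))"
    using damping_pos by (simp add: lyap_def field_simps)
  ultimately have ge: "inner (x - p) v + \<gamma> / 2 * (norm (x - p))\<^sup>2 + (norm v)\<^sup>2 / \<gamma> \<le> lyap p x v"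
    by linarith
  have "0 \<le> 1 / \<gamma> * (norm (v + (\<gamma> / 2) *\<^sub>R (x - p)))\<^sup>2"
    using damping_pos by simp
  also have "\<dots> = inner (x - p) v + \<gamma> / 4 * (norm (x - p))\<^sup>2 + (norm v)\<^sup>2 / \<gamma>"
    unfolding power2_norm_add_scaleR using damping_pos
    by (simp add: inner_commute field_simps power2_eq_square)
  finally show "\<gamma> / 4 * (norm (x - p))\<^sup>2 \<le> lyap p x v"
    using ge by (simp add: field_simps)
  have "0 \<le> \<gamma> / 2 * (norm ((x - p) + (1 / \<gamma>) *\<^sub>R v))\<^sup>2"
    using damping_pos by simp
  also have "\<dots> = inner (x - p) v + \<gamma> / 2 * (norm (x - p))\<^sup>2 + (norm v)\<^sup>2 / (2 * \<gamma>)"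
    unfolding power2_norm_add_scaleR using damping_pos
    by (simp add: inner_commute field_simps power2_eq_square)
  finally show "1 / (2 * \<gamma>) * (norm v)\<^sup>2 \<le> lyap p x v"
    using ge by (simp add: field_simps)
qed

lemma lyap_nonneg: "0 \<le> lyap p x v"
  using lyap_lower_bounds(2)[of v p x] damping_pos by (meson order_trans mult_nonneg_nonneg
      zero_le_power2 zero_le_divide_1_iff less_imp_le mult_pos_pos zero_less_numeral)

text \<open>With \<open>field p = 0\<close>, cocoercivity and monotonicity of \<open>B\<close> bound
  the rate by a quadratic form in \<open>v\<close> and \<open>A x - A p\<close>. Completing the
  square in one variable leaves the other with a negative coefficient; the two bounds feed the two
  square integrability claims.\<close>

lemma lyap_rate_le:
  assumes p: "field p = 0"
  shows "lyap_rate p x v \<le> - ((1 - 1 / (lam * \<gamma>\<^sup>2)) * (norm v)\<^sup>2)"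
    and "lyap_rate p x v \<le> - ((lam - 1 / \<gamma>\<^sup>2) * (norm (A x - A p))\<^sup>2)"
proof -
  define a where "a = A x - A p"
  have "lam * (norm a)\<^sup>2 \<le> inner (field x) (x - p)"
    using cocoerciveD[of x p] gradient_monotone[of x p] p
    by (simp add: a_def field_def inner_simps add_eq_0_iff)
  hence rate: "lyap_rate p x v \<le> - (norm v)\<^sup>2 - lam * (norm a)\<^sup>2 - 2 / \<gamma> * inner a v"
    by (simp add: lyap_rate_def a_def)
  have "0 \<le> lam * (norm (a + (1 / (lam * \<gamma>)) *\<^sub>R v))\<^sup>2"
    using lam_pos by simp
  also have "\<dots> = lam * (norm a)\<^sup>2 + 2 / \<gamma> * inner a v + 1 / (lam * \<gamma>\<^sup>2) * (norm v)\<^sup>2"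
    unfolding power2_norm_add_scaleR using damping_pos lam_pos
    by (simp add: inner_commute field_simps power2_eq_square)
  finally show "lyap_rate p x v \<le> - ((1 - 1 / (lam * \<gamma>\<^sup>2)) * (norm v)\<^sup>2)"
    using rate by (simp add: left_diff_distrib)
  have "0 \<le> (norm (v + (1 / \<gamma>) *\<^sub>R a))\<^sup>2"
    by simp
  also have "\<dots> = (norm v)\<^sup>2 + 2 / \<gamma> * inner a v + 1 / \<gamma>\<^sup>2 * (norm a)\<^sup>2"
    unfolding power2_norm_add_scaleR using damping_pos
    by (simp add: inner_commute field_simps power2_eq_square)
  finally show "lyap_rate p x v \<le> - ((lam - 1 / \<gamma>\<^sup>2) * (norm (A x - A p))\<^sup>2)"
    using rate by (simp add: left_diff_distrib a_def)
qed

lemma dissipation_coeffs_pos: "1 - 1 / (lam * \<gamma>\<^sup>2) > 0" "lam - 1 / \<gamma>\<^sup>2 > 0"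
  using damping_large damping_pos lam_pos by (auto simp: field_simps)

lemma lyap_rate_nonpos: "field p = 0 \<Longrightarrow> lyap_rate p x v \<le> 0"
  using lyap_rate_le(1)[of p x v] dissipation_coeffs_pos
  by (meson mult_nonneg_nonneg neg_le_0_iff_le order_trans zero_le_power2 less_imp_le)

lemma has_real_derivative_inner:
  fixes f g :: "real \<Rightarrow> 'h"
  assumes "(f has_vector_derivative f') (at t within T)" "(g has_vector_derivative g') (at t within T)"
  shows "((\<lambda>t. inner (f t) (g t)) has_real_derivative inner (f t) g' + inner f' (g t)) (at t within T)"
  using has_derivative_inner[OF assms[unfolded has_vector_derivative_def]]
  by (rule has_derivative_imp_has_field_derivative) (simp add: algebra_simps)

text \<open>Two cancellations shape the rate. The damping term produced by the pairing with
  \<open>u t - p\<close> cancels against the derivative of the squared distance, and the work of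
  \<open>B\<close> cancels against the Bregman part. Since \<open>A p = - B p\<close>, the only work
  left is that of \<open>A (u t) - A p\<close>.\<close>

lemma lyap_has_derivative:
  assumes p: "field p = 0"
    and u: "(u has_vector_derivative v t) (at t within T)"
    and v: "(v has_vector_derivative - (\<gamma> *\<^sub>R v t) - field (u t)) (at t within T)"
  shows "((\<lambda>t. lyap p (u t) (v t)) has_real_derivative lyap_rate p (u t) (v t)) (at t within T)"
proof -
  have up: "((\<lambda>t. u t - p) has_vector_derivative v t) (at t within T)"
    using u by (auto intro!: derivative_eq_intros)
  have phi: "((\<lambda>t. \<phi> (u t)) has_real_derivative inner (B (u t)) (v t)) (at t within T)"
    using has_derivative_compose[OF u[unfolded has_vector_derivative_def] potential_has_derivative]
    by (rule has_derivative_imp_has_field_derivative) (simp add: inner_commute)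
  have Ap: "A p = - B p"
    using p by (simp add: field_def add_eq_0_iff)
  note deriv = DERIV_add[OF DERIV_add[OF has_real_derivative_inner[OF up v]
        DERIV_cmult[OF has_real_derivative_inner[OF up up], of "\<gamma> / 2"]]
      DERIV_cmult[OF DERIV_diff[OF DERIV_diff[OF DERIV_add[OF
        DERIV_cdivide[OF has_real_derivative_inner[OF v v], of 2] phi] DERIV_const[of "\<phi> p"]]
        has_real_derivative_inner[OF has_vector_derivative_const[of "B p"] up]], of "2 / \<gamma>"]]
  show ?thesis
    unfolding lyap_def lyap_rate_def power2_norm_eq_inner
  proof (rule DERIV_cong[OF deriv])
    have "field (u t) = B (u t) + A (u t)"
      by (rule field_def)
    thus "inner (u t - p) (- (\<gamma> *\<^sub>R v t) - field (u t)) + inner (v t) (v t) +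
        \<gamma> / 2 * (inner (u t - p) (v t) + inner (v t) (u t - p)) +
        2 / \<gamma> * ((inner (v t) (- (\<gamma> *\<^sub>R v t) - field (u t)) +
          inner (- (\<gamma> *\<^sub>R v t) - field (u t)) (v t)) / 2 + inner (B (u t)) (v t) - 0 -
          (inner (B p) (v t) + inner 0 (u t - p))) =
      - inner (v t) (v t) - inner (field (u t)) (u t - p) - 2 / \<gamma> * inner (A (u t) - A p) (v t)"
      using damping_pos unfolding Ap
      by (simp add: inner_simps inner_commute field_simps)
  qed
qed

section \<open>Global existence and uniqueness of flows\<close>

lemma flow_onD:
  assumes "flow_on T u v" "t \<in> T"
  shows "(u has_vector_derivative v t) (at t within T)"
    and "(v has_vector_derivative - (\<gamma> *\<^sub>R v t) - field (u t)) (at t within T)"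
  using assms by (auto simp: flow_on_def)

lemma flow_on_continuous:
  assumes "flow_on T u v"
  shows "continuous_on T u" "continuous_on T v"
  by (auto simp: continuous_on_eq_continuous_within
      intro: has_vector_derivative_continuous flow_onD[OF assms])

lemma norm_le_lyap_radius: "norm x \<le> norm p + sqrt (4 / \<gamma> * lyap p x v)"
proof -
  have "(norm (x - p))\<^sup>2 \<le> 4 / \<gamma> * lyap p x v"
    using lyap_lower_bounds(1)[of x p v] damping_pos by (simp add: field_simps)
  hence "norm (x - p) \<le> sqrt (4 / \<gamma> * lyap p x v)"
    by (rule real_le_rsqrt)
  thus ?thesis
    using norm_triangle_sub[of x p] by linarith
qed

lemma lyap_continuous:
  assumes "continuous_on T u" "continuous_on T v"
  shows "continuous_on T (\<lambda>t. lyap p (u t) (v t))"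
proof -
  have "continuous_on UNIV \<phi>"
    by (rule has_derivative_continuous_on[OF potential_has_derivative])
  hence "continuous_on T (\<lambda>t. \<phi> (u t))"
    by (rule continuous_on_compose2[OF _ assms(1)]) simp
  thus ?thesis
    unfolding lyap_def by (intro continuous_intros assms) auto
qed

text \<open>The field is truncated outside a ball that trajectories cannot leave because \<open>lyap\<close>
  decreases until the first exit time.\<close>

lemma flow_exists:
  assumes p: "field p = 0"
  obtains u v where "flow_on {0..} u v" "u 0 = u0" "v 0 = v0"
proof -
  \<comment> \<open>The first two summands bound the position wherever \<open>lyap\<close> is at
    most its initial value; the extra 1 makes reaching the sphere of radius \<open>R\<close>
    contradictory.\<close>
  define R where "R = norm p + sqrt (4 / \<gamma> * lyap p u0 v0) + 1"
  have R: "R \<ge> 0"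
    unfolding R_def using lyap_nonneg damping_pos by (intro add_nonneg_nonneg) auto
  obtain L where "L-lipschitz_on (cball 0 R) field"
    using field_lipschitz[OF bounded_cball] ..
  moreover have "ball_retraction R ` UNIV \<subseteq> cball (0::'h) R"
    using norm_ball_retraction_le[OF R] by auto
  ultimately have "L-lipschitz_on (ball_retraction R ` UNIV) field"
    by (rule lipschitz_on_subset)
  from lipschitz_on_compose2[OF ball_retraction_lipschitz[OF R] this]
  obtain u v where uv: "u 0 = u0" "v 0 = v0"
    and u: "\<And>t. t \<ge> 0 \<Longrightarrow> (u has_vector_derivative v t) (at t within {0..})"
    and v: "\<And>t. t \<ge> 0 \<Longrightarrow>
      (v has_vector_derivative - (\<gamma> *\<^sub>R v t) - field (ball_retraction R (u t))) (at t within {0..})"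
    using damped_lipschitz_equation by blast
  have cont: "continuous_on {0..} u" "continuous_on {0..} v"
    by (auto simp: continuous_on_eq_continuous_within intro: has_vector_derivative_continuous u v)
  have inside: "norm (u t) < R" if "t \<ge> 0" for t
  proof (rule ccontr)
    assume "\<not> norm (u t) < R"
    define S where "S = {s \<in> {0..t}. R \<le> norm (u s)}"
    have "closed S"
      unfolding S_def
      by (intro continuous_on_closed_Collect_le continuous_intros continuous_on_subset[OF cont(1)]) auto
    moreover have "bounded S"
      by (rule bounded_subset[OF bounded_closed_interval[of 0 t]]) (auto simp: S_def)
    moreover have "t \<in> S"
      using that \<open>\<not> norm (u t) < R\<close> by (simp add: S_def)
    ultimately obtain \<tau> where "\<tau> \<in> S" and first: "\<And>s. s \<in> S \<Longrightarrow> \<tau> \<le> s"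
      using compact_attains_inf[of S] compact_eq_bounded_closed by blast
    hence \<tau>: "0 \<le> \<tau>" "\<tau> \<le> t" "R \<le> norm (u \<tau>)"
      by (auto simp: S_def)
    have before: "norm (u s) \<le> R" if "0 \<le> s" "s < \<tau>" for s
    proof -
      have "s \<notin> S"
        using first[of s] that by force
      thus ?thesis
        using that \<tau> by (auto simp: S_def)
    qed
    have "lyap p (u \<tau>) (v \<tau>) \<le> lyap p (u 0) (v 0)"
    \<comment> \<open>Strictly before \<open>\<tau>\<close> the truncation is inactive and
      \<open>u\<close>, \<open>v\<close> obey the original equation; continuity carries the decrease
      up to \<open>\<tau>\<close> itself.\<close>
    proof (rule DERIV_nonpos_imp_decreasing_open[OF \<tau>(1)])
      fix s assume s: "0 < s" "s < \<tau>"
      have "(v has_vector_derivative - (\<gamma> *\<^sub>R v s) - field (u s)) (at s within {0..})"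
        using v[of s] before[of s] s by (simp add: ball_retraction_eq)
      hence "((\<lambda>t. lyap p (u t) (v t)) has_real_derivative lyap_rate p (u s) (v s)) (at s within {0..})"
        using s by (intro lyap_has_derivative p u) auto
      moreover have "at s within {0..} = at s"
        using s by (intro at_within_interior) auto
      ultimately show "\<exists>y. ((\<lambda>t. lyap p (u t) (v t)) has_real_derivative y) (at s) \<and> y \<le> 0"
        using lyap_rate_nonpos[OF p] by auto
    next
      show "continuous_on {0..\<tau>} (\<lambda>t. lyap p (u t) (v t))"
        by (intro lyap_continuous continuous_on_subset[OF cont(1)] continuous_on_subset[OF cont(2)]) auto
    qed
    hence "sqrt (4 / \<gamma> * lyap p (u \<tau>) (v \<tau>)) \<le> sqrt (4 / \<gamma> * lyap p u0 v0)"
      using damping_pos uv by (intro real_sqrt_le_mono mult_left_mono) auto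
    hence "norm (u \<tau>) < R"
      using norm_le_lyap_radius[of "u \<tau>" p "v \<tau>"] unfolding R_def by linarith
    thus False
      using \<tau> by simp
  qed
  have "flow_on {0..} u v"
    unfolding flow_on_def
  proof (intro ballI conjI)
    fix t :: real assume t: "t \<in> {0..}"
    show "(u has_vector_derivative v t) (at t within {0..})"
      using t u by simp
    show "(v has_vector_derivative - (\<gamma> *\<^sub>R v t) - field (u t)) (at t within {0..})"
      using t v[of t] inside[of t] by (simp add: ball_retraction_eq)
  qed
  thus ?thesis
    using uv by (rule that)
qed

text \<open>Gronwall's argument for the squared phase-space distance. Both trajectories have compact
  images over \<open>{0..t}\<close>, which supplies one Lipschitz constant \<open>L\<close>; the
  damping contribution has a favourable sign and is dropped, leaving the growth rate
  \<open>1 + L\<close>.\<close>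

lemma flow_unique:
  assumes uv: "flow_on {0..} u v" and wz: "flow_on {0..} w z"
    and init: "u 0 = w 0" "v 0 = z 0" and "t \<ge> 0"
  shows "u t = w t"
proof -
  define X where "X = u ` {0..t} \<union> w ` {0..t}"
  have "compact (u ` {0..t})" "compact (w ` {0..t})"
    by (auto intro!: compact_continuous_image continuous_on_subset[OF flow_on_continuous(1)[OF uv]]
      continuous_on_subset[OF flow_on_continuous(1)[OF wz]])
  hence "bounded X"
    by (simp add: X_def compact_imp_bounded)
  then obtain L where L: "L-lipschitz_on X field"
    using field_lipschitz by blast
  have L0: "L \<ge> 0"
    using L by (rule lipschitz_on_nonneg)
  define N where "N s = inner (u s - w s) (u s - w s) + inner (v s - z s) (v s - z s)" for s
  define N' where "N' s = 2 * inner (u s - w s) (v s - z s) +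
    2 * inner (v s - z s) ((- (\<gamma> *\<^sub>R v s) - field (u s)) - (- (\<gamma> *\<^sub>R z s) - field (w s)))" for s
  have N_deriv: "(N has_real_derivative N' s) (at s within {0..})" if "s \<ge> 0" for s
  proof -
    have s: "s \<in> {0..}"
      using that by simp
    note d = has_vector_derivative_diff[OF flow_onD(1)[OF uv s] flow_onD(1)[OF wz s]]
      has_vector_derivative_diff[OF flow_onD(2)[OF uv s] flow_onD(2)[OF wz s]]
    show ?thesis
      unfolding N_def[abs_def] N'_def
      by (rule DERIV_cong[OF DERIV_add[OF has_real_derivative_inner[OF d(1) d(1)]
              has_real_derivative_inner[OF d(2) d(2)]]])
         (simp add: inner_commute)
  qed
  have N'_le: "N' s \<le> (1 + L) * N s" if s: "s \<in> {0..t}" for s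
  proof -
    define a b c where "a = u s - w s" and "b = v s - z s" and "c = field (u s) - field (w s)"
    have "norm c \<le> L * norm a"
      using lipschitz_onD[OF L, of "u s" "w s"] s by (simp add: X_def dist_norm a_def c_def)
    hence "norm b * norm c \<le> norm b * (L * norm a)"
      by (rule mult_left_mono) simp
    hence "- inner b c \<le> L * (norm a * norm b)"
      using Cauchy_Schwarz_ineq2[of b c] by (simp add: mult_ac abs_le_iff)
    moreover have "inner a b \<le> norm a * norm b"
      by (rule norm_cauchy_schwarz)
    moreover have "0 \<le> \<gamma> * inner b b"
      using damping_pos by simp
    moreover have "N' s = 2 * inner a b - 2 * (\<gamma> * inner b b) - 2 * inner b c"
      by (simp add: N'_def a_def b_def c_def inner_simps algebra_simps)
    ultimately have "N' s \<le> (1 + L) * (2 * norm a * norm b)"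
      by (simp add: algebra_simps)
    also have "\<dots> \<le> (1 + L) * ((norm a)\<^sup>2 + (norm b)\<^sup>2)"
      using L0 sum_squares_bound[of "norm a" "norm b"] by (intro mult_left_mono) auto
    finally show ?thesis
      by (simp add: N_def a_def b_def power2_norm_eq_inner)
  qed
  have "N t * exp (- (1 + L) * t) \<le> N 0 * exp (- (1 + L) * 0)"
  proof (rule has_real_derivative_within_nonpos_antimono[where X = "{0..}" and
        f = "\<lambda>s. N s * exp (- (1 + L) * s)" and f' = "\<lambda>s. (N' s - (1 + L) * N s) * exp (- (1 + L) * s)"])
    fix s assume s: "s \<in> {0..t}"
    have "((\<lambda>s. exp (- (1 + L) * s)) has_real_derivative exp (- (1 + L) * s) * (- (1 + L))) (at s within {0..})"
      by (auto intro!: derivative_eq_intros)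
    from DERIV_mult[OF N_deriv this]
    show "((\<lambda>s. N s * exp (- (1 + L) * s)) has_real_derivative (N' s - (1 + L) * N s) * exp (- (1 + L) * s))
        (at s within {0..})"
      using s by (simp add: algebra_simps)
    show "(N' s - (1 + L) * N s) * exp (- (1 + L) * s) \<le> 0"
      using N'_le[OF s] by (intro mult_nonpos_nonneg) auto
  qed (use \<open>t \<ge> 0\<close> in auto)
  hence "N t \<le> 0"
    using init by (simp add: N_def mult_le_0_iff)
  moreover have "N t \<ge> inner (u t - w t) (u t - w t)"
    by (simp add: N_def)
  ultimately have "norm (u t - w t) ^ 2 \<le> 0"
    unfolding power2_norm_eq_inner by linarith
  thus ?thesis
    by simp
qed

section \<open>Flows and twice continuously differentiable solutions\<close>

lemma at_half_line_neq_bot: "t \<ge> 0 \<Longrightarrow> at t within {0::real..} \<noteq> bot"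
  using islimpt_subset[of t "{t..t + 1}" "{0..}"] by (auto simp: trivial_limit_within islimpt_Icc)

text \<open>\<open>vector_derivative\<close> returns the derivative only where it is unique, that is
  at limit points of the half-line; the endpoint 0 is one of them.\<close>

lemma flow_time_deriv:
  assumes flow: "flow_on {0..} u v" and "t \<ge> 0"
  shows "time_deriv u t = v t" and "time_deriv (time_deriv u) t = - (\<gamma> *\<^sub>R v t) - field (u t)"
    and "(time_deriv u has_vector_derivative - (\<gamma> *\<^sub>R v t) - field (u t)) (at t within {0..})"
proof -
  have v: "time_deriv u s = v s" if "s \<in> {0..}" for s
    unfolding time_deriv_def using that
    by (intro vector_derivative_within at_half_line_neq_bot flow_onD(1)[OF flow]) auto
  show "time_deriv u t = v t"
    using v \<open>t \<ge> 0\<close> by simp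
  show d: "(time_deriv u has_vector_derivative - (\<gamma> *\<^sub>R v t) - field (u t)) (at t within {0..})"
    by (rule has_vector_derivative_transform[OF _ v flow_onD(2)[OF flow]]) (use \<open>t \<ge> 0\<close> in auto)
  show "time_deriv (time_deriv u) t = - (\<gamma> *\<^sub>R v t) - field (u t)"
    unfolding time_deriv_def[of "time_deriv u"]
    by (rule vector_derivative_within[OF at_half_line_neq_bot[OF \<open>t \<ge> 0\<close>] d])
qed

lemma flow_is_C2_solution:
  assumes flow: "flow_on {0..} u v"
  shows "is_C2_solution \<gamma> B A (u 0) (v 0) u"
  unfolding is_C2_solution_def C2_half_line_def
proof (intro conjI allI impI)
  show "u differentiable_on {0..}"
    unfolding differentiable_on_def
    using flow_onD(1)[OF flow] by (auto intro: differentiableI_vector)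
  show "time_deriv u differentiable_on {0..}"
    unfolding differentiable_on_def
    using flow_time_deriv(3)[OF flow] by (auto intro: differentiableI_vector)
  have "continuous_on {0..} (\<lambda>t. - (\<gamma> *\<^sub>R v t) - field (u t))"
    by (intro continuous_intros flow_on_continuous[OF flow] continuous_on_compose2[OF field_continuous]) auto
  thus "continuous_on {0..} (time_deriv (time_deriv u))"
    by (rule continuous_on_eq) (simp add: flow_time_deriv(2)[OF flow])
qed (use flow_time_deriv[OF flow] in \<open>simp_all add: field_def\<close>)

lemma C2_solution_flow:
  assumes "is_C2_solution \<gamma> B A u0 v0 w"
  shows "flow_on {0..} w (time_deriv w)" "w 0 = u0" "time_deriv w 0 = v0"
proof -
  have diff: "w differentiable_on {0..}" "time_deriv w differentiable_on {0..}"
    using assms by (auto simp: is_C2_solution_def C2_half_line_def)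
  have eq: "time_deriv (time_deriv w) t + \<gamma> *\<^sub>R time_deriv w t + B (w t) + A (w t) = 0" if "t \<ge> 0" for t
    using assms that by (simp add: is_C2_solution_def)
  show "flow_on {0..} w (time_deriv w)"
    unfolding flow_on_def
  proof (intro ballI conjI)
    fix t :: real assume t: "t \<in> {0..}"
    show "(w has_vector_derivative time_deriv w t) (at t within {0..})"
      using diff(1) t unfolding time_deriv_def differentiable_on_def
      by (simp add: vector_derivative_works)
    have "(time_deriv w has_vector_derivative time_deriv (time_deriv w) t) (at t within {0..})"
      using diff(2) t unfolding time_deriv_def[of "time_deriv w"] differentiable_on_def
      by (simp add: vector_derivative_works)
    moreover have "time_deriv (time_deriv w) t = - (\<gamma> *\<^sub>R time_deriv w t) - field (w t)"
      using eq[of t] t by (simp add: field_def algebra_simps eq_neg_iff_add_eq_0)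
    ultimately show "(time_deriv w has_vector_derivative - (\<gamma> *\<^sub>R time_deriv w t) - field (w t)) (at t within {0..})"
      by simp
  qed
qed (use assms in \<open>auto simp: is_C2_solution_def\<close>)

section \<open>Boundedness and asymptotic behaviour of flows\<close>

lemma flow_lyap_deriv:
  assumes "flow_on {0..} u v" "field p = 0" "t \<ge> 0"
  shows "((\<lambda>t. lyap p (u t) (v t)) has_real_derivative lyap_rate p (u t) (v t)) (at t within {0..})"
  using assms by (intro lyap_has_derivative flow_onD[of "{0..}" u v]) auto

lemma flow_lyap_antimono:
  assumes "flow_on {0..} u v" "field p = 0" "0 \<le> s" "s \<le> t"
  shows "lyap p (u t) (v t) \<le> lyap p (u s) (v s)"
  by (rule has_real_derivative_within_nonpos_antimono[OF \<open>s \<le> t\<close> _ flow_lyap_deriv[OF assms(1,2)]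
        lyap_rate_nonpos[OF assms(2)]])
     (use assms in auto)

lemma flow_bounded:
  assumes flow: "flow_on {0..} u v" and p: "field p = 0"
  obtains K where "\<And>t. t \<ge> 0 \<Longrightarrow> norm (u t) \<le> K" "\<And>t. t \<ge> 0 \<Longrightarrow> norm (v t) \<le> K"
proof -
  define E where "E = lyap p (u 0) (v 0)"
  define K where "K = max (norm p + sqrt (4 / \<gamma> * E)) (sqrt (2 * \<gamma> * E))"
  have le: "lyap p (u t) (v t) \<le> E" if "t \<ge> 0" for t
    unfolding E_def using that by (intro flow_lyap_antimono[OF flow p]) auto
  show ?thesis
  proof
    fix t :: real assume t: "t \<ge> 0"
    have "sqrt (4 / \<gamma> * lyap p (u t) (v t)) \<le> sqrt (4 / \<gamma> * E)"
      using damping_pos le[OF t] by (intro real_sqrt_le_mono mult_left_mono) auto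
    thus "norm (u t) \<le> K"
      using norm_le_lyap_radius[of "u t" p "v t"] unfolding K_def by linarith
    have "1 / (2 * \<gamma>) * (norm (v t))\<^sup>2 \<le> E"
      using lyap_lower_bounds(2)[of "v t" p "u t"] le[OF t] by linarith
    hence "(norm (v t))\<^sup>2 \<le> 2 * \<gamma> * E"
      using damping_pos by (simp add: field_simps)
    hence "norm (v t) \<le> sqrt (2 * \<gamma> * E)"
      by (rule real_le_rsqrt)
    thus "norm (v t) \<le> K"
      unfolding K_def by linarith
  qed
qed

text \<open>A bootstrap: bounded velocity makes \<open>u\<close> Lipschitz, the field is Lipschitz
  on the bounded range of \<open>u\<close>, so the acceleration is bounded; then \<open>v\<close> is
  Lipschitz and, through the equation, so is the acceleration. These bounds feed the two
  Barbalat-type lemmas.\<close>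

lemma flow_lipschitz:
  assumes flow: "flow_on {0..} u v" and p: "field p = 0"
  obtains K M where "K-lipschitz_on {0..} v" "M-lipschitz_on {0..} (\<lambda>t. - (\<gamma> *\<^sub>R v t) - field (u t))"
proof -
  obtain K where K: "\<And>t. t \<ge> 0 \<Longrightarrow> norm (u t) \<le> K" "\<And>t. t \<ge> 0 \<Longrightarrow> norm (v t) \<le> K"
    using flow_bounded[OF flow p] by blast
  have K0: "K \<ge> 0"
    using K(1)[of 0] norm_ge_zero[of "u 0"] by linarith
  have "bounded (u ` {0..})"
    using K by (auto simp: bounded_iff)
  then obtain L where L: "L-lipschitz_on (u ` {0..}) field"
    using field_lipschitz by blast
  have L0: "L \<ge> 0"
    using L by (rule lipschitz_on_nonneg)
  have u_lip: "K-lipschitz_on {0..} u"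
  proof (rule lipschitz_onI[OF _ K0])
    fix s t :: real assume st: "s \<in> {0..}" "t \<in> {0..}"
    show "dist (u s) (u t) \<le> K * dist s t"
      unfolding dist_norm real_norm_def
      by (rule norm_diff_le_vector_derivative_bound[OF _ flow_onD(1)[OF flow] _ st]) (use K in auto)
  qed
  have Fu_lip: "(L * K)-lipschitz_on {0..} (\<lambda>t. field (u t))"
    by (rule lipschitz_on_compose2[OF u_lip L])
  define C where "C = \<gamma> * K + (norm (field (u 0)) + L * (2 * K))"
  have C: "norm (- (\<gamma> *\<^sub>R v t) - field (u t)) \<le> C" if "t \<ge> 0" for t
  proof -
    have "norm (field (u t) - field (u 0)) \<le> L * norm (u t - u 0)"
      using lipschitz_onD[OF L, of "u t" "u 0"] that by (simp add: dist_norm)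
    also have "\<dots> \<le> L * (2 * K)"
      using K(1)[OF that] K(1)[of 0] norm_triangle_ineq4[of "u t" "u 0"] L0
      by (intro mult_left_mono) auto
    finally have "norm (field (u t)) \<le> norm (field (u 0)) + L * (2 * K)"
      using norm_triangle_sub[of "field (u t)" "field (u 0)"] by linarith
    moreover have "norm (- (\<gamma> *\<^sub>R v t)) \<le> \<gamma> * K"
      using K(2)[OF that] damping_pos by simp
    ultimately show ?thesis
      unfolding C_def using norm_triangle_ineq4[of "- (\<gamma> *\<^sub>R v t)" "field (u t)"] by linarith
  qed
  have "C \<ge> 0"
    using C[of 0] norm_ge_zero[of "- (\<gamma> *\<^sub>R v 0) - field (u 0)"] by linarith
  have v_lip: "C-lipschitz_on {0..} v"
  proof (rule lipschitz_onI[OF _ \<open>C \<ge> 0\<close>])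
    fix s t :: real assume st: "s \<in> {0..}" "t \<in> {0..}"
    show "dist (v s) (v t) \<le> C * dist s t"
      unfolding dist_norm real_norm_def
      by (rule norm_diff_le_vector_derivative_bound[OF _ flow_onD(2)[OF flow] _ st]) (use C in auto)
  qed
  have "(\<bar>\<gamma>\<bar> * C + L * K)-lipschitz_on {0..} (\<lambda>t. - (\<gamma> *\<^sub>R v t) - field (u t))"
    by (intro lipschitz_on_diff lipschitz_on_minus lipschitz_on_cmult v_lip Fu_lip)
  with v_lip show ?thesis
    by (rule that)
qed

lemma flow_velocity_tendsto_zero:
  assumes flow: "flow_on {0..} u v" and p: "field p = 0"
  shows "(v \<longlongrightarrow> 0) at_top"
proof -
  obtain K where K: "\<And>t. t \<ge> 0 \<Longrightarrow> norm (u t) \<le> K" "\<And>t. t \<ge> 0 \<Longrightarrow> norm (v t) \<le> K"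
    using flow_bounded[OF flow p] by blast
  obtain M where M: "M-lipschitz_on {0..} v"
    using flow_lipschitz[OF flow p] by blast
  define \<delta> where "\<delta> = 1 - 1 / (lam * \<gamma>\<^sup>2)"
  have \<delta>: "\<delta> > 0"
    unfolding \<delta>_def by (rule dissipation_coeffs_pos)
  have "((\<lambda>t. \<delta> * (norm (v t))\<^sup>2) \<longlongrightarrow> 0) at_top"
  proof (rule dissipation_tendsto_zero[OF flow_lyap_deriv[OF flow p]])
    fix s t :: real assume st: "s \<ge> 0" "t \<ge> 0"
    \<comment> \<open>Factoring the difference of squares makes the squared speed Lipschitz, from
      the Lipschitz and uniform bounds on \<open>v\<close>.\<close>
    have "\<bar>(norm (v s))\<^sup>2 - (norm (v t))\<^sup>2\<bar> = \<bar>norm (v s) - norm (v t)\<bar> * \<bar>norm (v s) + norm (v t)\<bar>"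
      by (simp add: power2_eq_square square_diff_square_factored abs_mult mult.commute)
    also have "\<dots> \<le> (M * \<bar>s - t\<bar>) * (2 * K)"
    proof (rule mult_mono)
      show "\<bar>norm (v s) - norm (v t)\<bar> \<le> M * \<bar>s - t\<bar>"
        using norm_triangle_ineq3[of "v s" "v t"] lipschitz_onD[OF M, of s t] st by (simp add: dist_norm)
      show "\<bar>norm (v s) + norm (v t)\<bar> \<le> 2 * K"
        using K(2)[OF st(1)] K(2)[OF st(2)] by simp
    qed (use lipschitz_on_nonneg[OF M] in auto)
    finally have "\<delta> * \<bar>(norm (v s))\<^sup>2 - (norm (v t))\<^sup>2\<bar> \<le> \<delta> * ((M * \<bar>s - t\<bar>) * (2 * K))"
      using \<delta> by (intro mult_left_mono) auto
    moreover have "\<bar>\<delta> * (norm (v s))\<^sup>2 - \<delta> * (norm (v t))\<^sup>2\<bar> = \<delta> * \<bar>(norm (v s))\<^sup>2 - (norm (v t))\<^sup>2\<bar>"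
      using \<delta> by (simp add: abs_mult flip: right_diff_distrib)
    ultimately show "\<bar>\<delta> * (norm (v s))\<^sup>2 - \<delta> * (norm (v t))\<^sup>2\<bar> \<le> (\<delta> * M * 2 * K) * \<bar>s - t\<bar>"
      by (simp add: mult_ac)
  next
    fix t :: real
    show "\<delta> * (norm (v t))\<^sup>2 \<le> - lyap_rate p (u t) (v t)"
      using lyap_rate_le(1)[OF p, of "u t" "v t"] unfolding \<delta>_def by linarith
  qed (use \<delta> lyap_nonneg in auto)
  hence "((\<lambda>t. 1 / \<delta> * (\<delta> * (norm (v t))\<^sup>2)) \<longlongrightarrow> 1 / \<delta> * 0) at_top"
    by (rule tendsto_mult_left)
  hence "((\<lambda>t. sqrt ((norm (v t))\<^sup>2)) \<longlongrightarrow> sqrt 0) at_top"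
    using \<delta> by (intro tendsto_real_sqrt) simp
  thus ?thesis
    by (simp add: tendsto_norm_zero_iff)
qed

lemma flow_field_tendsto_zero:
  assumes flow: "flow_on {0..} u v" and p: "field p = 0"
  shows "((\<lambda>t. field (u t)) \<longlongrightarrow> 0) at_top"
proof -
  obtain M where M: "M-lipschitz_on {0..} (\<lambda>t. - (\<gamma> *\<^sub>R v t) - field (u t))"
    using flow_lipschitz[OF flow p] by blast
  have v: "(v \<longlongrightarrow> 0) at_top"
    by (rule flow_velocity_tendsto_zero[OF flow p])
  have "((\<lambda>t. - (\<gamma> *\<^sub>R v t) - field (u t)) \<longlongrightarrow> 0) at_top"
    by (rule lipschitz_derivative_tendsto_zero[OF v flow_onD(2)[OF flow] M]) simp
  hence "((\<lambda>t. - (\<gamma> *\<^sub>R v t) - (- (\<gamma> *\<^sub>R v t) - field (u t))) \<longlongrightarrow> - (\<gamma> *\<^sub>R 0) - 0) at_top"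
    by (intro tendsto_intros v)
  thus ?thesis
    by simp
qed

lemma flow_distance_converges:
  assumes flow: "flow_on {0..} u v" and p: "field p = 0"
  obtains l where "((\<lambda>t. norm (u t - p)) \<longlongrightarrow> l) at_top"
proof -
  obtain K where K: "\<And>t. t \<ge> 0 \<Longrightarrow> norm (u t) \<le> K" "\<And>t. t \<ge> 0 \<Longrightarrow> norm (v t) \<le> K"
    using flow_bounded[OF flow p] by blast
  define \<delta> where "\<delta> = 1 - 1 / (lam * \<gamma>\<^sup>2)"
  have \<delta>: "\<delta> > 0"
    unfolding \<delta>_def by (rule dissipation_coeffs_pos)
  define W where "W t = lyap p (u t) (v t)" for t
  obtain m where m: "(W \<longlongrightarrow> m) at_top"
    using antimono_bounded_below_tendsto[of 0 W 0] flow_lyap_antimono[OF flow p] lyap_nonneg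
    unfolding W_def by metis
  \<comment> \<open>The first two terms have derivative at most the squared speed, since the field
    is monotone and vanishes at \<open>p\<close>. The squared speed is at most
    \<open>1 / \<delta>\<close> times the dissipation of \<open>W\<close>, so adding
    \<open>1 / \<delta> * W t\<close> makes \<open>Z\<close> decrease, and the known limit of
    \<open>W\<close> can be subtracted again.\<close>
  define Z where "Z t = inner (u t - p) (v t) + \<gamma> / 2 * (norm (u t - p))\<^sup>2 + 1 / \<delta> * W t" for t
  define Z' where "Z' t = (norm (v t))\<^sup>2 - inner (field (u t)) (u t - p) + 1 / \<delta> * lyap_rate p (u t) (v t)" for t
  have Z_deriv: "(Z has_real_derivative Z' t) (at t within {0..})" if "t \<ge> 0" for t
  proof -
    have t: "t \<in> {0..}"
      using that by simp
    have up: "((\<lambda>t. u t - p) has_vector_derivative v t) (at t within {0..})"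
      using flow_onD(1)[OF flow t] by (auto intro!: derivative_eq_intros)
    show ?thesis
      unfolding Z_def Z'_def W_def power2_norm_eq_inner
      by (rule DERIV_cong[OF DERIV_add[OF DERIV_add[OF has_real_derivative_inner[OF up flow_onD(2)[OF flow t]]
              DERIV_cmult[OF has_real_derivative_inner[OF up up], of "\<gamma> / 2"]]
              DERIV_cmult[OF flow_lyap_deriv[OF flow p that], of "1 / \<delta>"]]])
         (simp add: inner_diff_right inner_commute field_simps)
  qed
  have "Z' t \<le> 0" for t
  proof -
    have "1 / \<delta> * lyap_rate p (u t) (v t) \<le> 1 / \<delta> * - (\<delta> * (norm (v t))\<^sup>2)"
      using lyap_rate_le(1)[OF p, of "u t" "v t"] \<delta> unfolding \<delta>_def by (intro mult_left_mono) auto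
    moreover have "0 \<le> inner (field (u t)) (u t - p)"
      using field_monotone[of "u t" p] p by simp
    ultimately show ?thesis
      using \<delta> by (simp add: Z'_def)
  qed
  hence Z_anti: "Z t \<le> Z s" if "0 \<le> s" "s \<le> t" for s t
    using that by (intro has_real_derivative_within_nonpos_antimono[OF _ _ Z_deriv]) auto
  have Z_bound: "- (K * K + norm p * K) \<le> Z t" if "t \<ge> 0" for t
  proof -
    have "K \<ge> 0"
      using order_trans[OF norm_ge_zero K(1)[of 0]] by simp
    hence "norm (u t - p) * norm (v t) \<le> (K + norm p) * K"
      using K[OF that] norm_triangle_ineq4[of "u t" p] by (intro mult_mono) auto
    hence "- (K * K + norm p * K) \<le> inner (u t - p) (v t)"
      using Cauchy_Schwarz_ineq2[of "u t - p" "v t"] by (simp add: algebra_simps abs_le_iff)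
    moreover have "0 \<le> \<gamma> / 2 * (norm (u t - p))\<^sup>2" "0 \<le> 1 / \<delta> * W t"
      using damping_pos \<delta> lyap_nonneg by (auto simp: W_def)
    ultimately show ?thesis
      unfolding Z_def by linarith
  qed
  obtain l where l: "(Z \<longlongrightarrow> l) at_top"
    by (rule antimono_bounded_below_tendsto[OF Z_anti Z_bound])
  have "((\<lambda>t. inner (u t - p) (v t)) \<longlongrightarrow> 0) at_top"
  proof (rule Lim_null_comparison)
    show "\<forall>\<^sub>F t in at_top. norm (inner (u t - p) (v t)) \<le> (K + norm p) * norm (v t)"
      using eventually_ge_at_top[of 0]
    proof eventually_elim
      case (elim t)
      have "norm (u t - p) * norm (v t) \<le> (K + norm p) * norm (v t)"
        using K(1)[OF elim] norm_triangle_ineq4[of "u t" p] by (intro mult_right_mono) auto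
      thus ?case
        using Cauchy_Schwarz_ineq2[of "u t - p" "v t"] by simp
    qed
    show "((\<lambda>t. (K + norm p) * norm (v t)) \<longlongrightarrow> 0) at_top"
      using flow_velocity_tendsto_zero[OF flow p]
      by (intro tendsto_mult_right_zero tendsto_norm_zero)
  qed
  \<comment> \<open>The definition of \<open>Z\<close> is solved for the distance: \<open>Z\<close>
    and \<open>W\<close> converge, and the mixed term vanishes because \<open>u\<close> is bounded
    and \<open>v\<close> tends to 0.\<close>
  hence "((\<lambda>t. sqrt (2 / \<gamma> * (Z t - inner (u t - p) (v t) - 1 / \<delta> * W t))) \<longlongrightarrow>
      sqrt (2 / \<gamma> * (l - 0 - 1 / \<delta> * m))) at_top"
    by (intro tendsto_intros l m)
  moreover have "sqrt (2 / \<gamma> * (Z t - inner (u t - p) (v t) - 1 / \<delta> * W t)) = norm (u t - p)" for t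
    using damping_pos by (simp add: Z_def)
  ultimately show ?thesis
    using that by simp
qed

text \<open>By the equation, the second function is the acceleration plus
  \<open>B (u t) + A p\<close>. It is a combination of \<open>v\<close> and
  \<open>A (u t) - A p\<close>, each controlled in square by the dissipation.\<close>

lemma flow_L2:
  assumes flow: "flow_on {0..} u v" and p: "field p = 0"
  shows "in_L2_half_line v"
    and "in_L2_half_line (\<lambda>t. - (\<gamma> *\<^sub>R v t) - (A (u t) - A p))"
proof -
  define \<delta> \<epsilon> where "\<delta> = 1 - 1 / (lam * \<gamma>\<^sup>2)" and "\<epsilon> = lam - 1 / \<gamma>\<^sup>2"
  have pos: "\<delta> > 0" "\<epsilon> > 0"
    unfolding \<delta>_def \<epsilon>_def by (rule dissipation_coeffs_pos)+
  have v: "(norm (v t))\<^sup>2 \<le> 1 / \<delta> * - lyap_rate p (u t) (v t)" for t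
    using lyap_rate_le(1)[OF p, of "u t" "v t"] pos unfolding \<delta>_def[symmetric] by (simp add: field_simps)
  have a: "(norm (A (u t) - A p))\<^sup>2 \<le> 1 / \<epsilon> * - lyap_rate p (u t) (v t)" for t
    using lyap_rate_le(2)[OF p, of "u t" "v t"] pos unfolding \<epsilon>_def[symmetric] by (simp add: field_simps)
  have cont: "continuous_on {0..} v" "continuous_on {0..} (\<lambda>t. A (u t))"
    using flow_on_continuous[OF flow]
    by (auto intro: continuous_on_compose2[OF lipschitz_on_continuous_on[OF A_lipschitz[of UNIV]]])
  show "in_L2_half_line v"
    by (rule in_L2_half_lineI[OF flow_lyap_deriv[OF flow p] v]) (use pos lyap_nonneg cont in auto)
  have sum: "(norm (- (\<gamma> *\<^sub>R v t) - (A (u t) - A p)))\<^sup>2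
      \<le> (2 * \<gamma>\<^sup>2 / \<delta> + 2 / \<epsilon>) * - lyap_rate p (u t) (v t)" for t
  proof -
    have "norm (- (\<gamma> *\<^sub>R v t) - (A (u t) - A p)) \<le> \<gamma> * norm (v t) + norm (A (u t) - A p)"
      using norm_triangle_ineq4[of "- (\<gamma> *\<^sub>R v t)" "A (u t) - A p"] damping_pos by simp
    hence "(norm (- (\<gamma> *\<^sub>R v t) - (A (u t) - A p)))\<^sup>2 \<le> (\<gamma> * norm (v t) + norm (A (u t) - A p))\<^sup>2"
      by (rule power_mono) simp
    also have "\<dots> \<le> 2 * \<gamma>\<^sup>2 * (norm (v t))\<^sup>2 + 2 * (norm (A (u t) - A p))\<^sup>2"
      using sum_squares_bound[of "\<gamma> * norm (v t)" "norm (A (u t) - A p)"]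
      by (simp add: power2_sum power_mult_distrib)
    also have "\<dots> \<le> 2 * \<gamma>\<^sup>2 * (1 / \<delta> * - lyap_rate p (u t) (v t)) + 2 * (1 / \<epsilon> * - lyap_rate p (u t) (v t))"
      by (intro add_mono mult_left_mono v a) auto
    finally show ?thesis
      by (simp add: algebra_simps)
  qed
  show "in_L2_half_line (\<lambda>t. - (\<gamma> *\<^sub>R v t) - (A (u t) - A p))"
    by (rule in_L2_half_lineI[OF flow_lyap_deriv[OF flow p] sum])
       (use pos lyap_nonneg cont in \<open>auto intro!: continuous_intros add_nonneg_nonneg\<close>)
qed

end

theorem theorem2p1:
  fixes \<phi> :: "'h::{real_inner, complete_space} \<Rightarrow> real"
    and grad\<phi> A :: "'h \<Rightarrow> 'h"
    and lam \<gamma> :: real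
    and u0 v0 :: 'h
  assumes "convex_on UNIV \<phi>"
    and "\<And>x. GDERIV \<phi> x :> grad\<phi> x"
    and "\<And>X. bounded X \<Longrightarrow> \<exists>L. L-lipschitz_on X grad\<phi>"
    and "maximal_monotone_operator (operator_graph A)"
    and "lam > 0"
    and "cocoercive lam A"
    and "\<gamma> > 0"
    and "zeros_of_sum grad\<phi> A \<noteq> {}"
    and "lam * \<gamma>\<^sup>2 > 1"
  shows "\<exists>u. is_C2_solution \<gamma> grad\<phi> A u0 v0 u \<and>
           (\<forall>w. is_C2_solution \<gamma> grad\<phi> A u0 v0 w \<longrightarrow> (\<forall>t\<ge>0. w t = u t)) \<and>
           (\<exists>u_inf \<in> zeros_of_sum grad\<phi> A. weakly_tendsto u u_inf at_top) \<and>
           (in_L2_half_line (time_deriv u) \<and>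
            ((\<lambda>t. norm (time_deriv u t)) \<longlongrightarrow> 0) at_top) \<and>
           (\<forall>p \<in> zeros_of_sum grad\<phi> A.
              in_L2_half_line (\<lambda>t. time_deriv (time_deriv u) t + grad\<phi> (u t) + A p)) \<and>
           (\<forall>p \<in> zeros_of_sum grad\<phi> A.
              \<exists>l. ((\<lambda>t. norm (u t - p)) \<longlongrightarrow> l) at_top)"
proof -
  interpret damped_system \<phi> grad\<phi> A lam \<gamma>
    using assms by unfold_locales
  have zeros: "p \<in> zeros_of_sum grad\<phi> A \<longleftrightarrow> field p = 0" for p
    by (simp add: zeros_of_sum_def field_def)
  \<comment> \<open>A single zero serves as the reference point of the Lyapunov function for
    existence, boundedness and decay; the claims quantified over \<open>p\<close> use the function
    centred at that \<open>p\<close>.\<close>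
  obtain q where q: "field q = 0"
    using assms(8) zeros by auto
  obtain u v where flow: "flow_on {0..} u v" and init: "u 0 = u0" "v 0 = v0"
    by (rule flow_exists[OF q])
  have sol: "is_C2_solution \<gamma> grad\<phi> A u0 v0 u"
    using flow_is_C2_solution[OF flow] init by simp
  have uniq: "w t = u t" if "is_C2_solution \<gamma> grad\<phi> A u0 v0 w" "t \<ge> 0" for w t
    using flow_unique[OF C2_solution_flow(1)[OF that(1)] flow] C2_solution_flow(2,3)[OF that(1)] init that(2)
    by simp
  obtain K where "\<And>t. t \<ge> 0 \<Longrightarrow> norm (u t) \<le> K"
    using flow_bounded[OF flow q] by blast
  hence "bounded (u ` {0..})"
    by (auto simp: bounded_iff)
  then obtain x where x: "field x = 0" "weakly_tendsto u x at_top"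
    using weakly_tendsto_zero_of_monotone[OF _ field_continuous field_monotone
        flow_field_tendsto_zero[OF flow q]] flow_distance_converges[OF flow] by metis
  have v: "in_L2_half_line (time_deriv u)"
    using flow_L2(1)[OF flow q] in_L2_half_line_cong[of "time_deriv u" v] flow_time_deriv(1)[OF flow]
    by simp
  have v_lim: "((\<lambda>t. norm (time_deriv u t)) \<longlongrightarrow> 0) at_top"
  proof (rule Lim_transform_eventually)
    show "((\<lambda>t. norm (v t)) \<longlongrightarrow> 0) at_top"
      by (intro tendsto_norm_zero flow_velocity_tendsto_zero[OF flow q])
    show "\<forall>\<^sub>F t in at_top. norm (v t) = norm (time_deriv u t)"
      using eventually_ge_at_top[of 0] by eventually_elim (simp add: flow_time_deriv(1)[OF flow])
  qed
  have accel: "in_L2_half_line (\<lambda>t. time_deriv (time_deriv u) t + grad\<phi> (u t) + A p)" if "field p = 0" for p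
  proof -
    have "time_deriv (time_deriv u) t + grad\<phi> (u t) + A p = - (\<gamma> *\<^sub>R v t) - (A (u t) - A p)" if "t > 0" for t
      using that by (simp add: flow_time_deriv(2)[OF flow] field_def)
    from in_L2_half_line_cong[OF this] show ?thesis
      using flow_L2(2)[OF flow that] by simp
  qed
  show ?thesis
  proof (intro exI[of _ u] conjI allI impI ballI)
    show "\<exists>u_inf \<in> zeros_of_sum grad\<phi> A. weakly_tendsto u u_inf at_top"
      using x zeros by blast
    show "\<exists>l. ((\<lambda>t. norm (u t - p)) \<longlongrightarrow> l) at_top" if "p \<in> zeros_of_sum grad\<phi> A" for p
      using flow_distance_converges[OF flow] that zeros by metis
  qed (use sol uniq v v_lim accel zeros in auto)
qed

end
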